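(* Let $\psi\colon\mathbb{F}_q\to\mathbb{C}^\times$ be a nontrivial additive character. Uniformly for $n\ge1$ and $k\ge1$, $$q^{-n}\sum_{f\in\mathcal{M}_{n,q}}\chi_{k,\psi}(f)\ll\frac{1+\log_q n+\sqrt{\log_q k}}{n}.$$ In particular, this tends to $0$ when $\log k=o(n^2)$ as $n\to\infty$.
   Context: $\mathcal{M}_{n,q}$ is the set of monic polynomials of degree $n$ in $\mathbb{F}_q[T]$. For monic $f$ with $T\nmid f$, factor $f=\prod_{j=1}^{\deg f}(T-\lambda_j)$ over $\overline{\mathbb{F}_q}$ and set $p_{-k}(f)=\sum_j\lambda_j^{-k}\in\mathbb{F}_q$. Define $\chi_{k,\psi}(f)=\psi(p_{-k}(f))$ if $\gcd(f,T)=1$ and $\chi_{k,\psi}(f)=0$ otherwise. The implied constant does not depend on $n$ or $k$. *)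

theory Defs
  imports
    Complex_Main
    "HOL-Library.Cardinality"
    "HOL-Library.Landau_Symbols"
    "HOL-Algebra.Algebraic_Closure_Type"
begin

definition monic_polys :: "nat \<Rightarrow> 'a::finite_field poly set" where
  "monic_polys n = {f. Polynomial.degree f = n \<and> Polynomial.lead_coeff f = 1}"

text \<open>
  The roots are taken with multiplicity in the algebraic closure. If \<open>f\<close> has no root at \<open>0\<close>,
  the power sum is invariant under Frobenius, so it lies in the base field and
  \<^const>\<open>of_ac\<close> only inverts the embedding \<^const>\<open>to_ac\<close>.
\<close>
definition neg_power_sum :: "nat \<Rightarrow> 'a::finite_field poly \<Rightarrow> 'a" where
  "neg_power_sum k f = of_ac (\<Sum>x\<in>#proots (map_poly to_ac f). inverse x ^ k)"

definition additive_character :: "('a::finite_field \<Rightarrow> complex) \<Rightarrow> bool" where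
  "additive_character \<psi> \<longleftrightarrow> (\<forall>x. \<psi> x \<noteq> 0) \<and> (\<forall>x y. \<psi> (x + y) = \<psi> x * \<psi> y)"

definition chi :: "nat \<Rightarrow> ('a::finite_field \<Rightarrow> complex) \<Rightarrow> 'a poly \<Rightarrow> complex" where
  "chi k \<psi> f = (if coprime f [:0, 1:] then \<psi> (neg_power_sum k f) else 0)"

end

theory Submission
  imports Defs "HOL-Number_Theory.Number_Theory" "HOL-Analysis.Analysis"
begin

text \<open>
  Write \<open>A\<^sub>n\<close> for the sum of \<open>\<chi>\<close> over monic polynomials of degree \<open>n\<close>, and \<open>S\<^sub>d\<close> for the sum of
  \<open>\<psi>(Tr(x\<^sup>-\<^sup>k))\<close> over the nonzero \<open>x\<close> in the field with \<open>q\<^sup>d\<close> elements. Counting the roots of a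
  polynomial along Frobenius orbits gives \<open>n A\<^sub>n = \<Sum>\<^bsub>1 \<le> d \<le> n\<^esub> S\<^sub>d A\<^bsub>n-d\<^esub>\<close>, so that
  \<open>n |A\<^sub>n| / q\<^sup>n \<le> \<Sum>\<^bsub>d \<le> n\<^esub> |S\<^sub>d| / q\<^sup>d\<close>. A second moment computation bounds \<open>|S\<^sub>d|\<close> by
  \<open>gcd(k, q\<^sup>d - 1) q\<^bsup>d/2\<^esup>\<close>, which is good unless \<open>d\<close> lies in the exceptional set
  \<open>gcd(k, q\<^sup>d - 1) > q\<^bsup>d/4\<^esup>\<close>.

  To see that there are only \<open>O(\<surd>(1 + log\<^sub>q k))\<close> exceptional \<open>d\<close>, let \<open>w\<^sub>e\<close> be the sum of
  \<open>\<Lambda>(r) / log q\<close> over the divisors \<open>r\<close> of \<open>k\<close> modulo which \<open>q\<close> has order \<open>e\<close>. Then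
  \<open>\<Sum>\<^bsub>e | d\<^esub> w\<^sub>e = log\<^sub>q gcd(k, q\<^sup>d - 1)\<close>, \<open>w\<^sub>e \<le> e\<close>, and the total mass of \<open>w\<close> is at most
  \<open>W = 1 + log\<^sub>q k\<close>. The divisors \<open>e\<close> of \<open>d\<close> with \<open>e\<^sup>3 > W d\<close> are handled by a first moment over \<open>d\<close>
  and the remaining ones by a second moment; both moments are \<open>O(\<surd>W)\<close>.
\<close>

section \<open>Integers with a large divisor sum\<close>

text \<open>A divisor r of k divides \<open>q^d - 1\<close> exactly when the order of q modulo r
  divides d, so the sum runs over the divisors of the gcd and collapses to its logarithm. An r
  sharing a factor with q has \<open>ord r q = 0\<close> and drops out because d > 0.\<close>

lemma mangoldt_sum_ord:
  fixes k q d :: nat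
  assumes "k > 0" "q \<ge> 2" "d > 0"
  shows "(\<Sum>r | r dvd k \<and> ord r q dvd d. mangoldt r :: real) = ln (gcd k (q ^ d - 1))"
proof -
  have q1: "q ^ d \<ge> 1" using assms by simp
  have "r dvd q ^ d - 1 \<longleftrightarrow> ord r q dvd d" for r
  proof -
    have "r dvd q ^ d - 1 \<longleftrightarrow> [q ^ d = 1] (mod r)"
      using q1 by (simp add: cong_altdef_nat)
    thus ?thesis using ord_divides[of q d r] by simp
  qed
  hence "{r. r dvd k \<and> ord r q dvd d} = {r. r dvd gcd k (q ^ d - 1)}" by auto
  thus ?thesis
    using mangoldt_sum[of "gcd k (q^d-1)", where ?'a = real] assms(1) by simp
qed

text \<open>Write f = g a and pull out the power of g. Since \<open>0 powr x = 0\<close>, the term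
  at a = 0 vanishes and the series is zeta(s).\<close>

lemma sum_multiples_powr_le:
  fixes g N :: nat and s :: real
  assumes "g > 0" "s > 1"
  shows "(\<Sum>f\<in>{f\<in>{1..N}. g dvd f}. real f powr - s) \<le> real g powr - s * (\<Sum>a. real a powr - s)"
proof -
  have summ: "summable (\<lambda>a. real a powr - s)"
    using assms by (simp add: summable_real_powr_iff)
  have sub: "{f\<in>{1..N}. g dvd f} \<subseteq> (\<lambda>a. g * a) ` {1..N}"
  proof
    fix f assume f: "f \<in> {f\<in>{1..N}. g dvd f}"
    then obtain a where a: "f = g * a" by auto
    have "a \<le> f" "a \<ge> 1" using a f assms(1) by (auto simp: Suc_le_eq intro: Nat.gr0I)
    thus "f \<in> (\<lambda>a. g * a) ` {1..N}" using a f order_trans[of a f N] by (intro image_eqI[of _ _ a]) auto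
  qed
  have "(\<Sum>f\<in>{f\<in>{1..N}. g dvd f}. real f powr - s) \<le> (\<Sum>f\<in>(\<lambda>a. g * a) ` {1..N}. real f powr - s)"
    by (rule sum_mono2[OF _ sub]) auto
  also have "\<dots> = (\<Sum>a\<in>{1..N}. real (g * a) powr - s)"
    using assms by (subst sum.reindex) (auto intro: inj_onI)
  also have "\<dots> = real g powr - s * (\<Sum>a\<in>{1..N}. real a powr - s)"
    by (simp add: powr_mult sum_distrib_left)
  also have "\<dots> \<le> real g powr - s * (\<Sum>a. real a powr - s)"
    by (intro mult_left_mono sum_le_suminf summ) auto
  finally show ?thesis .
qed

text \<open>The gcd is at most the sum of all common divisors g, which decouples f from f'. Each g
  then contributes at most g times the square of \<open>g powr - (5/4) * Z\<close>, of order
  \<open>g powr - (3/2)\<close>, which is summable.\<close>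

lemma gcd_double_sum_le:
  fixes N :: nat
  shows "(\<Sum>f\<in>{1..N}. \<Sum>f'\<in>{1..N}. real (gcd f f') * real f powr - (5/4) * real f' powr - (5/4))
     \<le> (\<Sum>a. real a powr - (3/2)) * (\<Sum>a. real a powr - (5/4))\<^sup>2"
proof -
  define Z where "Z = (\<Sum>a. real a powr - (5/4))"
  have Z0: "Z \<ge> 0" unfolding Z_def by (intro suminf_nonneg) (auto simp: summable_real_powr_iff)
  define T where "T g = (\<Sum>f\<in>{f\<in>{1..N}. g dvd f}. real f powr - (5/4))" for g
  have T: "T g \<le> real g powr - (5/4) * Z" if "g > 0" for g
    unfolding T_def Z_def by (rule sum_multiples_powr_le) (use that in auto)
  have T0: "T g \<ge> 0" for g unfolding T_def by (intro sum_nonneg) auto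
  have gcd: "real (gcd f f') \<le> (\<Sum>g\<in>{1..N}. if g dvd f \<and> g dvd f' then real g else 0)"
    if "f \<in> {1..N}" for f f'
  proof -
    have "gcd f f' \<in> {1..N}"
      using that gcd_le1_nat[of f f'] order_trans[of "gcd f f'" f N] by (auto simp: Suc_le_eq)
    hence "(if gcd f f' dvd f \<and> gcd f f' dvd f' then real (gcd f f') else 0) \<le> (\<Sum>g\<in>{1..N}. if g dvd f \<and> g dvd f' then real g else 0)"
      by (intro member_le_sum) auto
    thus ?thesis by simp
  qed
  have "(\<Sum>f\<in>{1..N}. \<Sum>f'\<in>{1..N}. real (gcd f f') * real f powr - (5/4) * real f' powr - (5/4))
     \<le> (\<Sum>f\<in>{1..N}. \<Sum>f'\<in>{1..N}. (\<Sum>g\<in>{1..N}. if g dvd f \<and> g dvd f' then real g else 0) * real f powr - (5/4) * real f' powr - (5/4))"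
    by (intro sum_mono mult_right_mono gcd) auto
  also have "\<dots> = (\<Sum>f\<in>{1..N}. \<Sum>f'\<in>{1..N}. \<Sum>g\<in>{1..N}. real g * ((if g dvd f then real f powr - (5/4) else 0) * (if g dvd f' then real f' powr - (5/4) else 0)))"
    unfolding sum_distrib_right by (intro sum.cong refl) auto
  also have "\<dots> = (\<Sum>f\<in>{1..N}. \<Sum>g\<in>{1..N}. \<Sum>f'\<in>{1..N}. real g * ((if g dvd f then real f powr - (5/4) else 0) * (if g dvd f' then real f' powr - (5/4) else 0)))"
    by (intro sum.cong refl sum.swap)
  also have "\<dots> = (\<Sum>g\<in>{1..N}. \<Sum>f\<in>{1..N}. \<Sum>f'\<in>{1..N}. real g * ((if g dvd f then real f powr - (5/4) else 0) * (if g dvd f' then real f' powr - (5/4) else 0)))"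
    by (rule sum.swap)
  also have "\<dots> = (\<Sum>g\<in>{1..N}. real g * (T g)\<^sup>2)"
  proof (intro sum.cong refl)
    fix g assume "g \<in> {1..N}"
    have "T g = (\<Sum>f\<in>{1..N}. if g dvd f then real f powr - (5/4) else 0)"
      unfolding T_def by (rule sum.inter_filter) auto
    thus "(\<Sum>f\<in>{1..N}. \<Sum>f'\<in>{1..N}. real g * ((if g dvd f then real f powr - (5/4) else 0) * (if g dvd f' then real f' powr - (5/4) else 0))) = real g * (T g)\<^sup>2"
      by (simp only: power2_eq_square sum_product) (simp only: sum_distrib_left)
  qed
  also have "\<dots> \<le> (\<Sum>g\<in>{1..N}. real g powr - (3/2) * Z\<^sup>2)"
  proof (intro sum_mono)
    fix g assume g: "g \<in> {1..N}"
    have "real g * (T g)\<^sup>2 \<le> real g * (real g powr - (5/4) * Z)\<^sup>2"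
      using T[of g] T0[of g] g by (intro mult_left_mono power_mono) auto
    also have "(real g powr - (5/4))\<^sup>2 = real g powr - (5/2)"
      using g by (simp add: powr_power)
    hence "real g * (real g powr - (5/4) * Z)\<^sup>2 = real g powr 1 * real g powr - (5/2) * Z\<^sup>2"
      using g by (simp add: power_mult_distrib)
    also have "\<dots> = real g powr - (3/2) * Z\<^sup>2"
      by (subst powr_add[symmetric]) simp
    finally show "real g * (T g)\<^sup>2 \<le> real g powr - (3/2) * Z\<^sup>2" .
  qed
  also have "\<dots> = (\<Sum>g\<in>{1..N}. real g powr - (3/2)) * Z\<^sup>2" by (simp add: sum_distrib_right)
  also have "\<dots> \<le> (\<Sum>a. real a powr - (3/2)) * Z\<^sup>2"
    by (intro mult_right_mono sum_le_suminf) (auto simp: summable_real_powr_iff)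
  finally show ?thesis unfolding Z_def .
qed

section \<open>Counting over multiples, and the two moments of the divisor sum\<close>

lemma card_multiples_le:
  fixes l :: nat and z :: real
  assumes "l > 0" "z \<ge> 0"
  shows "finite {d. d > 0 \<and> l dvd d \<and> real d \<le> z}" "real (card {d. d > 0 \<and> l dvd d \<and> real d \<le> z}) \<le> z / real l"
proof -
  have sub: "{d. d > 0 \<and> l dvd d \<and> real d \<le> z} \<subseteq> (\<lambda>a. l * a) ` {1..nat \<lfloor>z / real l\<rfloor>}"
  proof
    fix d assume d: "d \<in> {d. d > 0 \<and> l dvd d \<and> real d \<le> z}"
    then obtain a where a: "d = l * a" by auto
    have "real a \<le> z / real l" using a d assms by (simp add: field_simps)
    hence "a \<le> nat \<lfloor>z / real l\<rfloor>" by (simp add: le_nat_floor)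
    thus "d \<in> (\<lambda>a. l * a) ` {1..nat \<lfloor>z / real l\<rfloor>}" using a d by (auto simp: Suc_le_eq)
  qed
  thus "finite {d. d > 0 \<and> l dvd d \<and> real d \<le> z}" by (rule finite_subset) auto
  have "card {d. d > 0 \<and> l dvd d \<and> real d \<le> z} \<le> card ((\<lambda>a. l * a) ` {1..nat \<lfloor>z / real l\<rfloor>})"
    by (rule card_mono[OF _ sub]) auto
  also have "\<dots> \<le> nat \<lfloor>z / real l\<rfloor>" using card_image_le[of "{1..nat \<lfloor>z / real l\<rfloor>}"] by simp
  finally have "real (card {d. d > 0 \<and> l dvd d \<and> real d \<le> z}) \<le> real (nat \<lfloor>z / real l\<rfloor>)" by simp
  also have "\<dots> \<le> z / real l" using assms by simp
  finally show "real (card {d. d > 0 \<and> l dvd d \<and> real d \<le> z}) \<le> z / real l" .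
qed

lemma sum_inverse_atMost_real_le:
  fixes z :: real
  assumes "z \<ge> 1" "finite A" "\<And>f. f \<in> A \<Longrightarrow> f > 0 \<and> real f \<le> z"
  shows "(\<Sum>f\<in>A. 1 / real f) \<le> 1 + ln z"
proof -
  define m where "m = nat \<lfloor>z\<rfloor>"
  have m: "m \<ge> 1" "real m \<le> z" using assms(1) unfolding m_def by (auto simp: le_nat_iff le_floor_iff)
  have "(\<Sum>f\<in>A. 1 / real f) \<le> (\<Sum>f\<in>{1..m}. 1 / real f)"
    using assms(3) by (intro sum_mono2) (auto simp: m_def le_nat_floor Suc_le_eq)
  also have "\<dots> = harm m" by (simp add: harm_def field_simps)
  also have "\<dots> \<le> ln (real m) + 1"
  proof -
    \<comment> \<open>H_m - ln m is decreasing and equals 1 at m = 1;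
      \<open>decseq_harm_diff_ln\<close> is indexed from the successor.\<close>
    have "harm (Suc (m-1)) - ln (real (Suc (m-1))) \<le> harm (Suc 0) - ln (real (Suc 0))"
      using decseq_harm_diff_ln by (rule decseqD) auto
    thus ?thesis using m by (simp add: harm_def)
  qed
  also have "\<dots> \<le> 1 + ln z" using m assms(1) by (simp add: ln_mono)
  finally show ?thesis .
qed


text \<open>Markov's inequality at threshold 1; other thresholds are absorbed by scaling h.\<close>

lemma card_le_sum_of_ge:
  fixes h :: "'b \<Rightarrow> real"
  assumes "finite S" "\<And>x. x \<in> S \<Longrightarrow> h x \<ge> 0"
  shows "real (card {x\<in>S. h x \<ge> 1}) \<le> (\<Sum>x\<in>S. h x)"
proof -
  have "real (card {x\<in>S. h x \<ge> 1}) = (\<Sum>x\<in>{x\<in>S. h x \<ge> 1}. 1)" by simp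
  also have "\<dots> \<le> (\<Sum>x\<in>{x\<in>S. h x \<ge> 1}. h x)" by (intro sum_mono) auto
  also have "\<dots> \<le> (\<Sum>x\<in>S. h x)" using assms by (intro sum_mono2) auto
  finally show ?thesis .
qed

text \<open>Sum over d first. For fixed e and d = e f, the condition becomes f < (e / Y)^2 with Y =
  \<open>sqrt W\<close>, so the reciprocals 1 / d add up to a harmonic sum divided by e. This is at
  most 2 / Y for every e, and the total mass W of w leaves 2 W / Y = 2 Y.\<close>

lemma sum_large_divisors_le:
  fixes w :: "nat \<Rightarrow> real" and W :: real
  assumes "W > 0" "\<And>e. w e \<ge> 0" "(\<Sum>e=1..n. w e) \<le> W"
  shows "(\<Sum>d=1..n. (\<Sum>e\<in>{e\<in>{1..n}. e dvd d \<and> real e ^ 3 > W * real d}. w e) / real d) \<le> 2 * sqrt W"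
proof -
  define Y where "Y = sqrt W"
  have Y: "Y > 0" "Y * Y = W" using assms(1) by (auto simp: Y_def)
  have inner: "(\<Sum>d\<in>{d\<in>{1..n}. e dvd d \<and> real e ^ 3 > W * real d}. 1 / real d) \<le> 2 / Y"
    if e: "e \<in> {1..n}" for e
  proof -
    define D where "D = {d\<in>{1..n}. e dvd d \<and> real e ^ 3 > W * real d}"
    define F where "F = (\<lambda>d. d div e) ` D"
    have D: "D = (\<lambda>f. e * f) ` F"
      unfolding F_def image_image by (force simp: D_def)
    have F: "f > 0 \<and> real f < (real e / Y) ^ 2" if "f \<in> F" for f
    proof -
      from that D have d: "e * f \<in> D" by blast
      hence "W * (real e * real f) < real e * real e ^ 2" by (simp add: D_def power3_eq_cube power2_eq_square mult_ac)
      hence "real e * (W * real f) < real e * real e ^ 2" by (simp add: mult_ac)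
      hence "W * real f < real e ^ 2" using e by simp
      thus ?thesis using d e Y assms(1) by (auto simp: D_def power_divide field_simps power2_eq_square intro: Nat.gr0I)
    qed
    show ?thesis
    proof (cases "F = {}")
      case True
      thus ?thesis using D Y unfolding D_def[symmetric] by simp
    next
      case False
      then obtain f where "f \<in> F" by auto
      \<comment> \<open>A positive integer lies below (e / Y)^2, so e > Y; the harmonic bound needs
        its range to reach 1.\<close>
      from F[OF this] have "1 < (real e / Y) ^ 2" by linarith
      hence t: "real e / Y > 1" using Y by (smt (verit) power_le_one divide_nonneg_pos of_nat_0_le_iff)
      have "(\<Sum>d\<in>D. 1 / real d) = (\<Sum>f\<in>F. 1 / real (e * f))"
        unfolding D using e by (subst sum.reindex) (auto intro: inj_onI)
      also have "\<dots> = (\<Sum>f\<in>F. 1 / real f) / real e"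
        by (simp add: sum_divide_distrib mult.commute)
      also have "\<dots> \<le> (1 + ln ((real e / Y) ^ 2)) / real e"
      proof (intro divide_right_mono sum_inverse_atMost_real_le)
        show "finite F" by (simp add: F_def D_def)
        show "1 \<le> (real e / Y)\<^sup>2" using t by simp
        show "f > 0 \<and> real f \<le> (real e / Y)\<^sup>2" if "f \<in> F" for f using F[OF that] by auto
      qed simp
      also have "ln ((real e / Y) ^ 2) = 2 * ln (real e / Y)" using t by (simp add: ln_realpow)
      \<comment> \<open>Trading the logarithm for a linear term gives a factor e, which cancels the
        e in the denominator and makes the bound uniform in e.\<close>
      also have "ln (real e / Y) \<le> real e / Y - 1" using t by (intro ln_le_minus_one) auto
      hence "(1 + 2 * ln (real e / Y)) / real e \<le> (2 * (real e / Y)) / real e"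
        by (intro divide_right_mono) auto
      also have "\<dots> = 2 / Y" using e by simp
      finally show ?thesis unfolding D_def .
    qed
  qed
  have "(\<Sum>d=1..n. (\<Sum>e\<in>{e\<in>{1..n}. e dvd d \<and> real e ^ 3 > W * real d}. w e) / real d)
      = (\<Sum>d=1..n. \<Sum>e=1..n. if e dvd d \<and> real e ^ 3 > W * real d then w e / real d else 0)"
    unfolding sum_divide_distrib by (intro sum.cong refl sum.inter_filter) auto
  also have "\<dots> = (\<Sum>e=1..n. \<Sum>d=1..n. if e dvd d \<and> real e ^ 3 > W * real d then w e / real d else 0)"
    by (rule sum.swap)
  also have "\<dots> = (\<Sum>e=1..n. w e * (\<Sum>d\<in>{d\<in>{1..n}. e dvd d \<and> real e ^ 3 > W * real d}. 1 / real d))"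
    unfolding sum.inter_filter[OF finite_atLeastAtMost] sum_distrib_left by (intro sum.cong refl) auto
  also have "\<dots> \<le> (\<Sum>e=1..n. w e * (2 / Y))"
    by (intro sum_mono mult_left_mono inner assms(2))
  also have "\<dots> = (\<Sum>e=1..n. w e) * (2 / Y)" by (rule sum_distrib_right[symmetric])
  also have "\<dots> \<le> W * (2 / Y)" using assms(3) Y by (intro mult_right_mono) auto
  also have "\<dots> = 2 * Y" using Y by (simp add: field_simps flip: Y(2))
  finally show ?thesis by (simp add: Y_def)
qed

text \<open>Expanding the square counts, for each pair f, f', the multiples d of
  \<open>lcm f f'\<close> up to a bound z. Writing the lcm through the gcd turns the sum over pairs
  into the convergent one of \<open>gcd_double_sum_le\<close>.\<close>

lemma sum_small_divisors_square_le:
  fixes W :: real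
  assumes "W > 0"
  shows "(\<Sum>d=1..n. (\<Sum>f\<in>{f\<in>{1..n}. f dvd d \<and> real d ^ 2 \<le> W * real f ^ 3}. 1 / real f) ^ 2)
    \<le> sqrt W * ((\<Sum>a. real a powr - (3/2)) * (\<Sum>a. real a powr - (5/4))\<^sup>2)"
proof -
  define P where "P d f \<longleftrightarrow> f dvd d \<and> real d ^ 2 \<le> W * real f ^ 3" for d f :: nat
  have pair: "real (card {d\<in>{1..n}. P d f \<and> P d f'}) * (1 / real f * (1 / real f'))
      \<le> sqrt W * (real (gcd f f') * real f powr - (5/4) * real f' powr - (5/4))"
    if "f \<in> {1..n}" "f' \<in> {1..n}" for f f'
  proof -
    have pos: "f > 0" "f' > 0" using that by auto
    \<comment> \<open>This is the geometric mean of the two upper bounds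
      \<open>sqrt (W * f^3)\<close> and \<open>sqrt (W * f'^3)\<close> on d.\<close>
    define z where "z = sqrt W * (real f * real f') powr (3/4)"
    have z0: "z \<ge> 0" using assms by (simp add: z_def)
    have z4: "z ^ 4 = W ^ 2 * (real f ^ 3 * real f' ^ 3)"
    proof -
      have "((real f * real f') powr (3/4)) ^ 4 = (real f * real f') powr 3"
        using pos by (simp add: powr_power)
      also have "\<dots> = real f ^ 3 * real f' ^ 3"
        using pos by (simp add: power_mult_distrib)
      moreover have "sqrt W ^ 4 = (sqrt W ^ 2) ^ 2" by simp
      ultimately show ?thesis using assms by (simp add: z_def power_mult_distrib)
    qed
    have "{d\<in>{1..n}. P d f \<and> P d f'} \<subseteq> {d. d > 0 \<and> lcm f f' dvd d \<and> real d \<le> z}"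
    proof clarify
      fix d assume d: "d \<in> {1..n}" "P d f" "P d f'"
      have "real d ^ 4 = real d ^ 2 * real d ^ 2" by simp
      also have "\<dots> \<le> (W * real f ^ 3) * (W * real f' ^ 3)"
        using d assms by (intro mult_mono) (auto simp: P_def)
      also have "\<dots> = z ^ 4" unfolding z4 by (simp add: power2_eq_square mult_ac)
      finally have "real d \<le> z" using z0 by (rule power_le_imp_le_base[of _ 3, simplified]) 
      thus "d > 0 \<and> lcm f f' dvd d \<and> real d \<le> z" using d by (auto simp: P_def)
    qed
    hence "card {d\<in>{1..n}. P d f \<and> P d f'} \<le> card {d. d > 0 \<and> lcm f f' dvd d \<and> real d \<le> z}"
      using card_multiples_le(1)[of "lcm f f'" z] pos z0 by (intro card_mono) (auto simp: lcm_pos_nat)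
    hence "real (card {d\<in>{1..n}. P d f \<and> P d f'}) \<le> z / real (lcm f f')"
      using card_multiples_le(2)[of "lcm f f'" z] pos z0 by (simp add: lcm_pos_nat)
    hence "real (card {d\<in>{1..n}. P d f \<and> P d f'}) * (1 / real f * (1 / real f')) \<le> z / real (lcm f f') * (1 / real f * (1 / real f'))"
      by (intro mult_right_mono) auto
    also have "real (lcm f f') = real f * real f' / real (gcd f f')"
    proof -
      have "real (gcd f f') * real (lcm f f') = real f * real f'"
        by (metis of_nat_mult prod_gcd_lcm_nat)
      thus ?thesis using pos by (simp add: field_simps)
    qed
    also have "z / (real f * real f' / real (gcd f f')) * (1 / real f * (1 / real f'))
        = sqrt W * (real (gcd f f') * ((real f * real f') powr (3/4) / (real f * real f') ^ 2))"
      unfolding z_def by (simp add: power2_eq_square)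
    also have "(real f * real f') powr (3/4) / (real f * real f') ^ 2 = (real f * real f') powr (3/4 - 2)"
      using pos by (subst powr_diff) (auto simp: powr_numeral)
    also have "\<dots> = real f powr - (5/4) * real f' powr - (5/4)"
      by (simp add: powr_mult)
    finally show ?thesis by (simp add: mult_ac)
  qed
  have "(\<Sum>d=1..n. (\<Sum>f\<in>{f\<in>{1..n}. P d f}. 1 / real f) ^ 2)
     = (\<Sum>d=1..n. \<Sum>f=1..n. \<Sum>f'=1..n. if P d f \<and> P d f' then 1 / real f * (1 / real f') else 0)"
    unfolding sum.inter_filter[OF finite_atLeastAtMost] power2_eq_square sum_product
    by (intro sum.cong refl) auto
  also have "\<dots> = (\<Sum>f=1..n. \<Sum>d=1..n. \<Sum>f'=1..n. if P d f \<and> P d f' then 1 / real f * (1 / real f') else 0)"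
    by (rule sum.swap)
  also have "\<dots> = (\<Sum>f=1..n. \<Sum>f'=1..n. \<Sum>d=1..n. if P d f \<and> P d f' then 1 / real f * (1 / real f') else 0)"
    by (intro sum.cong refl sum.swap)
  also have "\<dots> = (\<Sum>f=1..n. \<Sum>f'=1..n. real (card {d\<in>{1..n}. P d f \<and> P d f'}) * (1 / real f * (1 / real f')))"
    by (intro sum.cong refl, subst sum.inter_filter[symmetric]) auto
  also have "\<dots> \<le> (\<Sum>f=1..n. \<Sum>f'=1..n. sqrt W * (real (gcd f f') * real f powr - (5/4) * real f' powr - (5/4)))"
    by (intro sum_mono pair)
  also have "\<dots> = sqrt W * (\<Sum>f=1..n. \<Sum>f'=1..n. real (gcd f f') * real f powr - (5/4) * real f' powr - (5/4))"
    by (simp add: sum_distrib_left)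
  also have "\<dots> \<le> sqrt W * ((\<Sum>a. real a powr - (3/2)) * (\<Sum>a. real a powr - (5/4))\<^sup>2)"
    using assms by (intro mult_left_mono gcd_double_sum_le) auto
  finally show ?thesis unfolding P_def .
qed

text \<open>For \<open>d = e f\<close>, the conditions \<open>e\<^sup>3 \<le> W d\<close> and \<open>d\<^sup>2 \<le> W f\<^sup>3\<close> are equivalent.\<close>
lemma card_large_divisor_sum_le:
  fixes w :: "nat \<Rightarrow> real" and W c :: real
  assumes "W > 0" "c > 0" "\<And>e. w e \<ge> 0" "\<And>e. e > 0 \<Longrightarrow> w e \<le> real e" "(\<Sum>e=1..n. w e) \<le> W"
  shows "real (card {d\<in>{1..n}. c * real d \<le> (\<Sum>e | e dvd d. w e)})
     \<le> (4 / c + 4 / c\<^sup>2 * ((\<Sum>a. real a powr - (3/2)) * (\<Sum>a. real a powr - (5/4))\<^sup>2)) * sqrt W"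
proof -
  define b where "b d = (\<Sum>e\<in>{e\<in>{1..n}. e dvd d \<and> real e ^ 3 > W * real d}. w e) / real d" for d
  define s where "s d = (\<Sum>f\<in>{f\<in>{1..n}. f dvd d \<and> real d ^ 2 \<le> W * real f ^ 3}. 1 / real f)" for d
  have b0: "b d \<ge> 0" for d unfolding b_def using assms(3) by (intro divide_nonneg_nonneg sum_nonneg) auto
  have s0: "s d \<ge> 0" for d unfolding s_def by (intro sum_nonneg) auto
  have split: "(\<Sum>e | e dvd d. w e) \<le> real d * b d + real d * s d" if d: "d \<in> {1..n}" for d
  proof -
    have dvd: "{e. e dvd d} = {e\<in>{1..n}. e dvd d}"
      using d by (auto dest: dvd_imp_le simp: Suc_le_eq intro: Nat.gr0I)
    have "(\<Sum>e | e dvd d. w e) = (\<Sum>e\<in>{e\<in>{1..n}. e dvd d \<and> real e ^ 3 > W * real d}. w e) + (\<Sum>e\<in>{e\<in>{1..n}. e dvd d \<and> real e ^ 3 \<le> W * real d}. w e)"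
      unfolding dvd by (subst sum.union_disjoint[symmetric]) (auto intro!: sum.cong)
    \<comment> \<open>Small divisors get the weight bound e = d / f, where f is the complementary
      divisor; passing from e to f produces d times \<open>s d\<close>.\<close>
    also have "(\<Sum>e\<in>{e\<in>{1..n}. e dvd d \<and> real e ^ 3 \<le> W * real d}. w e) \<le> (\<Sum>e\<in>{e\<in>{1..n}. e dvd d \<and> real e ^ 3 \<le> W * real d}. real e)"
      by (intro sum_mono assms(4)) auto
    also have "\<dots> = (\<Sum>f\<in>{f\<in>{1..n}. f dvd d \<and> real d ^ 2 \<le> W * real f ^ 3}. real d * (1 / real f))"
    proof -
      have div: "d div e \<in> {1..n}" "d div (d div e) = e" "d div e dvd d" "real (d div e) = real d / real e" if "e \<in> {1..n}" "e dvd d" for e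
        using that d div_le_dividend[of d e] order_trans[of "d div e" d n]
        by (auto elim!: dvdE simp: Suc_le_eq simp del: div_le_dividend)
      have iff: "real e ^ 3 \<le> W * real d \<longleftrightarrow> real d ^ 2 \<le> W * real (d div e) ^ 3" if "e \<in> {1..n}" "e dvd d" for e
      proof -
        have "real d ^ 2 \<le> W * real (d div e) ^ 3 \<longleftrightarrow> real d ^ 2 * real e ^ 3 \<le> W * real d ^ 3"
          unfolding div(4)[OF that] using that by (simp add: power_divide field_simps)
        also have "\<dots> \<longleftrightarrow> real d ^ 2 * real e ^ 3 \<le> real d ^ 2 * (W * real d)"
          by (simp add: power2_eq_square power3_eq_cube mult_ac)
        also have "\<dots> \<longleftrightarrow> real e ^ 3 \<le> W * real d" using d by (subst mult_le_cancel_left_pos) auto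
        finally show ?thesis by simp
      qed
      have iff': "real (d div f) ^ 3 \<le> W * real d \<longleftrightarrow> real d ^ 2 \<le> W * real f ^ 3" if "f \<in> {1..n}" "f dvd d" for f
        using iff[of "d div f"] div[OF that] by metis
      have eq: "real d * (1 / real (d div e)) = real e" if "e \<in> {1..n}" "e dvd d" for e
        unfolding div(4)[OF that] using d by simp
      show ?thesis
        by (rule sum.reindex_bij_witness[of _ "\<lambda>f. d div f" "\<lambda>e. d div e"])
          (use div(1-3) iff iff' eq in blast)+
    qed
    also have "\<dots> = real d * s d" unfolding s_def by (simp add: sum_distrib_left)
    finally show ?thesis using d by (simp add: b_def)
  qed
  \<comment> \<open>If the divisor sum reaches c d, then \<open>b d\<close> or \<open>s d\<close> is
    at least c / 2. The factors 2 / c and 4 / c^2 normalise both events to threshold 1, for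
    \<open>b\<close> itself and for the square of \<open>s\<close>.\<close>
  have "{d\<in>{1..n}. c * real d \<le> (\<Sum>e | e dvd d. w e)}
      \<subseteq> {d\<in>{1..n}. 2 / c * b d \<ge> 1} \<union> {d\<in>{1..n}. 4 / c\<^sup>2 * s d ^ 2 \<ge> 1}"
  proof
    fix d assume d: "d \<in> {d\<in>{1..n}. c * real d \<le> (\<Sum>e | e dvd d. w e)}"
    hence "real d * c \<le> real d * (b d + s d)" using split[of d] by (simp add: algebra_simps)
    hence "c \<le> b d + s d" using d by simp
    hence "b d \<ge> c / 2 \<or> s d \<ge> c / 2" by linarith
    thus "d \<in> {d\<in>{1..n}. 2 / c * b d \<ge> 1} \<union> {d\<in>{1..n}. 4 / c\<^sup>2 * s d ^ 2 \<ge> 1}"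
    proof
      assume "b d \<ge> c / 2"
      thus ?thesis using d assms(2) by (simp add: field_simps)
    next
      assume "s d \<ge> c / 2"
      hence "s d ^ 2 \<ge> (c / 2) ^ 2" using assms(2) by (intro power_mono) auto
      thus ?thesis using d assms(2) by (simp add: field_simps)
    qed
  qed
  hence "card {d\<in>{1..n}. c * real d \<le> (\<Sum>e | e dvd d. w e)}
      \<le> card ({d\<in>{1..n}. 2 / c * b d \<ge> 1} \<union> {d\<in>{1..n}. 4 / c\<^sup>2 * s d ^ 2 \<ge> 1})"
    by (intro card_mono) auto
  also have "\<dots> \<le> card {d\<in>{1..n}. 2 / c * b d \<ge> 1} + card {d\<in>{1..n}. 4 / c\<^sup>2 * s d ^ 2 \<ge> 1}"
    by (rule card_Un_le)
  finally have "real (card {d\<in>{1..n}. c * real d \<le> (\<Sum>e | e dvd d. w e)})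
     \<le> real (card {d\<in>{1..n}. 2 / c * b d \<ge> 1}) + real (card {d\<in>{1..n}. 4 / c\<^sup>2 * s d ^ 2 \<ge> 1})" by linarith
  also have "\<dots> \<le> (\<Sum>d=1..n. 2 / c * b d) + (\<Sum>d=1..n. 4 / c\<^sup>2 * s d ^ 2)"
    using b0 assms(2) by (intro add_mono card_le_sum_of_ge) auto
  also have "\<dots> = 2 / c * (\<Sum>d=1..n. b d) + 4 / c\<^sup>2 * (\<Sum>d=1..n. s d ^ 2)"
    by (simp add: sum_distrib_left)
  also have "\<dots> \<le> 2 / c * (2 * sqrt W) + 4 / c\<^sup>2 * (sqrt W * ((\<Sum>a. real a powr - (3/2)) * (\<Sum>a. real a powr - (5/4))\<^sup>2))"
    unfolding b_def s_def using assms
    by (intro add_mono mult_left_mono sum_large_divisors_le sum_small_divisors_square_le) auto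
  finally show ?thesis by (simp add: algebra_simps)
qed

text \<open>Taking logarithms to base q, a gcd above \<open>q powr (d / 4)\<close> means that the
  masses w_e of the divisors e of d add up to more than d / 4, so
  \<open>card_large_divisor_sum_le\<close> applies with c = 1/4.\<close>

lemma card_large_gcd_le:
  fixes q :: nat
  assumes "q \<ge> 2"
  obtains C :: real where "C \<ge> 0" and
    "\<And>n k. k \<ge> 1 \<Longrightarrow> real (card {d\<in>{1..n}. real q powr (real d / 4) < real (gcd k (q ^ d - 1))})
        \<le> C * sqrt (1 + log (real q) (real k))"
proof -
  define C :: real where "C = 4 / (1/4) + 4 / (1/4)\<^sup>2 * ((\<Sum>a. real a powr - (3/2)) * (\<Sum>a. real a powr - (5/4))\<^sup>2)"
  have "C \<ge> 0" unfolding C_def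
    by (intro add_nonneg_nonneg mult_nonneg_nonneg suminf_nonneg zero_le_power) (auto simp: summable_real_powr_iff)
  moreover have "real (card {d\<in>{1..n}. real q powr (real d / 4) < real (gcd k (q ^ d - 1))})
        \<le> C * sqrt (1 + log (real q) (real k))" if k: "k \<ge> 1" for n k
  proof -
    have lnq: "ln (real q) > 0" using assms by simp
    define w where "w e = (\<Sum>r | r dvd k \<and> ord r q = e. mangoldt r) / ln (real q)" for e
    have fin: "finite {r. r dvd k}" using k by simp
    have w0: "w e \<ge> 0" for e unfolding w_def using lnq by (intro divide_nonneg_pos sum_nonneg mangoldt_nonneg)
    have sumw: "(\<Sum>e\<in>E. w e) = (\<Sum>r | r dvd k \<and> ord r q \<in> E. mangoldt r) / ln (real q)" if "finite E" for E
    proof -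
      have "(\<Sum>r | r dvd k \<and> ord r q \<in> E. mangoldt r :: real)
          = (\<Sum>e\<in>E. \<Sum>r\<in>{r\<in>{r. r dvd k \<and> ord r q \<in> E}. ord r q = e}. mangoldt r)"
        using that fin by (intro sum.group[symmetric]) auto
      also have "\<dots> = (\<Sum>e\<in>E. \<Sum>r | r dvd k \<and> ord r q = e. mangoldt r)"
        by (intro sum.cong) auto
      finally show ?thesis unfolding w_def by (simp add: sum_divide_distrib)
    qed
    have wd: "(\<Sum>e | e dvd d. w e) = log (real q) (real (gcd k (q ^ d - 1)))" if "d > 0" for d
      using mangoldt_sum_ord[of k q d] k assms that by (subst sumw) (auto simp: log_def)
    \<comment> \<open>\<open>w e\<close> is one of the nonnegative terms that add up to the
      logarithm of gcd(k, q^e - 1), and that gcd is below q^e.\<close>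
    have we: "w e \<le> real e" if e: "e > 0" for e
    proof -
      have "w e \<le> (\<Sum>e' | e' dvd e. w e')"
        using e w0 by (intro member_le_sum) auto
      also have "\<dots> = log (real q) (real (gcd k (q ^ e - 1)))" using e by (rule wd)
      also have "\<dots> \<le> log (real q) (real (q ^ e))"
      proof -
        have "q ^ e > 1" using assms e by (intro one_less_power) auto
        hence "gcd k (q ^ e - 1) \<le> q ^ e - 1" by (intro gcd_le2_nat) auto
        hence "gcd k (q ^ e - 1) \<le> q ^ e" by linarith
        moreover have "gcd k (q ^ e - 1) > 0" using k by simp
        ultimately show ?thesis using assms by (intro log_mono) (auto simp flip: of_nat_power)
      qed
      also have "\<dots> = real e" using assms by (simp add: log_nat_power)
      finally show ?thesis .
    qed
    have "(\<Sum>e=1..n. w e) \<le> (\<Sum>r | r dvd k. mangoldt r) / ln (real q)"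
      using fin lnq by (subst sumw) (auto intro!: divide_right_mono sum_mono2 mangoldt_nonneg)
    also have "\<dots> = log (real q) (real k)" using mangoldt_sum[of k, where ?'a = real] k by (simp add: log_def)
    \<comment> \<open>The added 1 keeps the mass bound positive at k = 1, where the logarithm
      vanishes.\<close>
    finally have W: "(\<Sum>e=1..n. w e) \<le> 1 + log (real q) (real k)" by simp
    have W0: "1 + log (real q) (real k) > 0" using k assms by (intro add_pos_nonneg) auto
    have "{d\<in>{1..n}. real q powr (real d / 4) < real (gcd k (q ^ d - 1))} \<subseteq> {d\<in>{1..n}. 1/4 * real d \<le> (\<Sum>e | e dvd d. w e)}"
    proof clarify
      fix d assume d: "d \<in> {1..n}" "real q powr (real d / 4) < real (gcd k (q ^ d - 1))"
      hence "real d / 4 < log (real q) (real (gcd k (q ^ d - 1)))"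
        using assms k by (subst less_log_iff) auto
      thus "1/4 * real d \<le> (\<Sum>e | e dvd d. w e)" using d wd[of d] by simp
    qed
    hence "real (card {d\<in>{1..n}. real q powr (real d / 4) < real (gcd k (q ^ d - 1))}) \<le> real (card {d\<in>{1..n}. 1/4 * real d \<le> (\<Sum>e | e dvd d. w e)})"
      by (intro of_nat_mono card_mono) auto
    also have "\<dots> \<le> C * sqrt (1 + log (real q) (real k))"
      unfolding C_def by (intro card_large_divisor_sum_le W0 w0 we W) auto
    finally show ?thesis .
  qed
  ultimately show ?thesis using that by blast
qed

section \<open>Power sums of an additive character\<close>

text \<open>
  The sum \<open>S(b)\<close> of \<open>\<Psi>(b x\<^sup>k)\<close> takes the same value at all nonzero \<open>k\<close>-th powers \<open>b\<close>, so its second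
  moment over \<open>b\<close> controls \<open>S(1)\<close>.
\<close>
lemma power_character_sum_bound:
  fixes F :: "'b::field set" and \<Psi> :: "'b \<Rightarrow> complex" and k :: nat
  assumes fin: "finite F" and card1: "card F > 1"
    and diff: "\<And>x y. x \<in> F \<Longrightarrow> y \<in> F \<Longrightarrow> x - y \<in> F"
    and mult: "\<And>x y. x \<in> F \<Longrightarrow> y \<in> F \<Longrightarrow> x * y \<in> F"
    and divi: "\<And>x y. x \<in> F \<Longrightarrow> y \<in> F \<Longrightarrow> x / y \<in> F"
    and pow: "\<And>x. x \<in> F \<Longrightarrow> x ^ card F = x"
    and add: "\<And>x y. x \<in> F \<Longrightarrow> y \<in> F \<Longrightarrow> \<Psi> (x + y) = \<Psi> x * \<Psi> y"
    and norm1: "\<And>x. x \<in> F \<Longrightarrow> norm (\<Psi> x) = 1"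
    and nontriv: "z0 \<in> F" "\<Psi> z0 \<noteq> 1"
  shows "norm (\<Sum>x\<in>F-{0}. \<Psi> (x ^ k)) \<le> real (gcd k (card F - 1)) * sqrt (real (card F))"
proof -
  define g where "g = gcd k (card F - 1)"
  have g0: "g > 0" using card1 by (simp add: g_def)
  have F0: "0 \<in> F" using diff[OF nontriv(1) nontriv(1)] by simp
  have F1: "1 \<in> F"
  proof -
    have "\<not> F \<subseteq> {0}" using card1 card_mono[of "{0}" F] by auto
    then obtain x where "x \<in> F" "x \<noteq> 0" by auto
    thus ?thesis using divi[of x x] by simp
  qed
  have Fpow: "x ^ n \<in> F" if "x \<in> F" for x n
    by (induction n) (use F1 mult that in auto)
  have Fadd: "x + y \<in> F" if "x \<in> F" "y \<in> F" for x y
    using diff[OF that(1) diff[OF F0 that(2)]] by simp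
  have Psi0: "\<Psi> 0 = 1"
    using add[OF F0 F0] norm1[OF F0] by auto
  have cnj: "cnj (\<Psi> y) = \<Psi> (- y)" if "y \<in> F" for y
  proof -
    have "- y \<in> F" using diff[OF F0 that] by simp
    hence "\<Psi> y * \<Psi> (- y) = 1" using add[OF that, of "-y"] Psi0 by simp
    moreover have "\<Psi> y * cnj (\<Psi> y) = 1" using norm1[OF that] by (simp add: complex_mult_cnj cmod_def)
    moreover have "\<Psi> y \<noteq> 0" using norm1[OF that] by auto
    ultimately show ?thesis by (metis mult_cancel_left)
  qed
  have orth: "(\<Sum>b\<in>F. \<Psi> (b * z)) = (if z = 0 then of_nat (card F) else 0)" if z: "z \<in> F" for z
  proof (cases "z = 0")
    case True
    thus ?thesis by (simp add: Psi0)
  next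
    case False
    \<comment> \<open>Shifting b by this b0 multiplies the sum by \<open>\<Psi> z0\<close>, which
      differs from 1, so the sum is zero.\<close>
    define b0 where "b0 = z0 / z"
    have b0: "b0 \<in> F" "b0 * z = z0" using False divi[OF nontriv(1) z] by (auto simp: b0_def)
    have "(\<Sum>b\<in>F. \<Psi> (b * z)) = (\<Sum>b\<in>F. \<Psi> ((b + b0) * z))"
      by (rule sum.reindex_bij_witness[of _ "\<lambda>b. b + b0" "\<lambda>b. b - b0"]) (use b0 diff Fadd in auto)
    also have "\<dots> = (\<Sum>b\<in>F. \<Psi> (b * z) * \<Psi> z0)"
      by (intro sum.cong refl) (use mult z nontriv b0 in \<open>simp add: distrib_right add\<close>)
    also have "\<dots> = (\<Sum>b\<in>F. \<Psi> (b * z)) * \<Psi> z0" by (simp add: sum_distrib_right)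
    finally have "(\<Sum>b\<in>F. \<Psi> (b * z)) * (\<Psi> z0 - 1) = 0" by (simp add: algebra_simps)
    thus ?thesis using nontriv False by simp
  qed
  \<comment> \<open>The quotient of two solutions is a root of unity for the exponents k and
    \<open>card F - 1\<close>, hence by Bezout for their gcd g; the polynomial X^g - 1 has at most g
    roots.\<close>
  have fibre: "card {y\<in>F-{0}. y ^ k = c} \<le> g" for c
  proof (cases "{y\<in>F-{0}. y ^ k = c} = {}")
    case True
    thus ?thesis by (metis card.empty le0)
  next
    case False
    then obtain y0 where y0: "y0 \<in> F" "y0 \<noteq> 0" "y0 ^ k = c" by auto
    have roots: "(y / y0) ^ g = 1" if "y \<in> {y\<in>F-{0}. y ^ k = c}" for y
    proof -
      define t where "t = y / y0"
      have t: "t \<in> F" "t \<noteq> 0" using that y0 divi by (auto simp: t_def)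
      have tk: "t ^ k = 1" using that y0 by (auto simp: t_def power_divide)
      have "t * t ^ (card F - 1) = t" using pow[OF t(1)] card1 by (simp flip: power_Suc)
      hence tN: "t ^ (card F - 1) = 1" using t by simp
      show ?thesis
      proof (cases "k = 0")
        case True
        thus ?thesis using tN by (simp add: g_def t_def)
      next
        case False
        then obtain u v where uv: "k * u = (card F - 1) * v + g"
          using bezout_nat[of k "card F - 1"] by (auto simp: g_def)
        have "t ^ (k * u) = t ^ ((card F - 1) * v) * t ^ g" unfolding uv by (simp add: power_add)
        thus ?thesis using tk tN by (simp add: power_mult t_def)
      qed
    qed
    have ne: "Polynomial.monom 1 g - 1 \<noteq> (0 :: 'b poly)"
    proof
      assume "Polynomial.monom 1 g - 1 = (0 :: 'b poly)"
      hence "Polynomial.coeff (Polynomial.monom 1 g - 1 :: 'b poly) g = 0" by simp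
      thus False using g0 by simp
    qed
    have deg: "Polynomial.degree (Polynomial.monom 1 g - 1 :: 'b poly) \<le> g"
      by (rule degree_diff_le) (auto simp: degree_monom_le)
    have "card {y\<in>F-{0}. y ^ k = c} \<le> card {t. poly (Polynomial.monom 1 g - 1) t = (0 :: 'b)}"
    proof (rule card_inj_on_le[of "\<lambda>y. y / y0"])
      show "inj_on (\<lambda>y. y / y0) {y\<in>F-{0}. y ^ k = c}" using y0 by (auto intro: inj_onI)
      show "(\<lambda>y. y / y0) ` {y\<in>F-{0}. y ^ k = c} \<subseteq> {t. poly (Polynomial.monom 1 g - 1) t = (0 :: 'b)}"
        using roots by (auto simp: poly_monom)
      show "finite {t. poly (Polynomial.monom 1 g - 1) t = (0 :: 'b)}" by (rule poly_roots_finite[OF ne])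
    qed
    also have "\<dots> \<le> g" using card_poly_roots_bound[OF ne] deg by linarith
    finally show ?thesis .
  qed
  define S where "S b = (\<Sum>x\<in>F-{0}. \<Psi> (b * x ^ k))" for b
  define N where "N = card (F - {0})"
  have N: "N = card F - 1" "N > 0" using F0 fin card1 by (auto simp: N_def)
  \<comment> \<open>Second moment: after expanding the square, orthogonality in b leaves only the
    pairs with equal k-th powers, at most g of them for each x.\<close>
  have "(\<Sum>b\<in>F. of_real ((norm (S b))\<^sup>2)) = (\<Sum>b\<in>F. \<Sum>x\<in>F-{0}. \<Sum>y\<in>F-{0}. \<Psi> (b * (x ^ k - y ^ k)))"
  proof (intro sum.cong refl)
    fix b assume b: "b \<in> F"
    have "of_real ((norm (S b))\<^sup>2) = S b * cnj (S b)" using complex_norm_square[of "S b"] by simp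
    also have "\<dots> = (\<Sum>x\<in>F-{0}. \<Sum>y\<in>F-{0}. \<Psi> (b * x ^ k) * cnj (\<Psi> (b * y ^ k)))"
      unfolding S_def cnj_sum sum_product ..
    also have "\<dots> = (\<Sum>x\<in>F-{0}. \<Sum>y\<in>F-{0}. \<Psi> (b * (x ^ k - y ^ k)))"
    proof (intro sum.cong refl)
      fix x y assume xy: "x \<in> F - {0}" "y \<in> F - {0}"
      have m: "b * x ^ k \<in> F" "b * y ^ k \<in> F" using xy b Fpow mult by auto
      hence "- (b * y ^ k) \<in> F" using diff[OF F0] by force
      thus "\<Psi> (b * x ^ k) * cnj (\<Psi> (b * y ^ k)) = \<Psi> (b * (x ^ k - y ^ k))"
        using cnj[OF m(2)] add[OF m(1), of "- (b * y ^ k)"] by (simp add: algebra_simps)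
    qed
    finally show "of_real ((norm (S b))\<^sup>2) = (\<Sum>x\<in>F-{0}. \<Sum>y\<in>F-{0}. \<Psi> (b * (x ^ k - y ^ k)))" .
  qed
  also have "\<dots> = (\<Sum>x\<in>F-{0}. \<Sum>b\<in>F. \<Sum>y\<in>F-{0}. \<Psi> (b * (x ^ k - y ^ k)))"
    by (rule sum.swap)
  also have "\<dots> = (\<Sum>x\<in>F-{0}. \<Sum>y\<in>F-{0}. \<Sum>b\<in>F. \<Psi> (b * (x ^ k - y ^ k)))"
    by (intro sum.cong refl sum.swap)
  also have "\<dots> = (\<Sum>x\<in>F-{0}. \<Sum>y\<in>F-{0}. if y ^ k = x ^ k then of_nat (card F) else 0)"
    by (intro sum.cong refl, subst orth) (auto intro!: diff Fpow)
  also have "\<dots> = (\<Sum>x\<in>F-{0}. of_nat (card {y\<in>F-{0}. y ^ k = x ^ k} * card F))"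
    using fin by (intro sum.cong refl, subst sum.inter_filter[symmetric]) auto
  also have "\<dots> = complex_of_real (\<Sum>x\<in>F-{0}. real (card {y\<in>F-{0}. y ^ k = x ^ k}) * real (card F))"
    by simp
  finally have "complex_of_real (\<Sum>b\<in>F. (norm (S b))\<^sup>2) = complex_of_real (\<Sum>x\<in>F-{0}. real (card {y\<in>F-{0}. y ^ k = x ^ k}) * real (card F))"
    by simp
  hence "(\<Sum>b\<in>F. (norm (S b))\<^sup>2) = (\<Sum>x\<in>F-{0}. real (card {y\<in>F-{0}. y ^ k = x ^ k}) * real (card F))"
    by (simp only: of_real_eq_iff)
  also have "\<dots> \<le> (\<Sum>x\<in>F-{0}. real g * real (card F))"
    by (intro sum_mono mult_right_mono of_nat_mono fibre) auto
  finally have second: "(\<Sum>b\<in>F. (norm (S b))\<^sup>2) \<le> real N * (real g * real (card F))"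
    by (simp add: N_def)
  \<comment> \<open>The substitution of y x for x absorbs the factor y^k.\<close>
  have inv: "S (y ^ k) = S 1" if y: "y \<in> F - {0}" for y
    unfolding S_def
    by (rule sum.reindex_bij_witness[of _ "\<lambda>x. x / y" "\<lambda>x. y * x"])
      (use y mult divi in \<open>auto simp: power_mult_distrib\<close>)
  \<comment> \<open>Averaging over y reproduces S(1), while each b occurs as y^k at most g times.
    Here g enters a second time, so the square root of the final bound contains g itself.\<close>
  have "real N * (norm (S 1))\<^sup>2 = (\<Sum>y\<in>F-{0}. (norm (S (y ^ k)))\<^sup>2)"
    by (simp add: inv N_def)
  also have "\<dots> = (\<Sum>b\<in>F. \<Sum>y\<in>{y\<in>F-{0}. y ^ k = b}. (norm (S (y ^ k)))\<^sup>2)"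
    using fin by (intro sum.group[symmetric]) (auto intro!: Fpow)
  also have "\<dots> = (\<Sum>b\<in>F. real (card {y\<in>F-{0}. y ^ k = b}) * (norm (S b))\<^sup>2)"
    by (intro sum.cong refl) simp
  also have "\<dots> \<le> (\<Sum>b\<in>F. real g * (norm (S b))\<^sup>2)"
    by (intro sum_mono mult_right_mono of_nat_mono fibre) auto
  also have "\<dots> = real g * (\<Sum>b\<in>F. (norm (S b))\<^sup>2)" by (simp add: sum_distrib_left)
  also have "\<dots> \<le> real g * (real N * (real g * real (card F)))"
    by (intro mult_left_mono second) auto
  finally have "real N * (norm (S 1))\<^sup>2 \<le> real N * ((real g)\<^sup>2 * real (card F))"
    by (simp add: power2_eq_square mult_ac)
  hence "(norm (S 1))\<^sup>2 \<le> (real g)\<^sup>2 * real (card F)" using N by simp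
  also have "\<dots> = (real g * sqrt (real (card F)))\<^sup>2" by (simp add: power_mult_distrib)
  finally have "norm (S 1) \<le> real g * sqrt (real (card F))"
    by (rule power2_le_imp_le) auto
  thus ?thesis by (simp add: S_def g_def)
qed

section \<open>Frobenius on the algebraic closure\<close>

text \<open>Adding x to itself p times, with p the characteristic, gives 0, so every value of \<psi>
  is a p-th root of unity.\<close>

lemma norm_additive_character:
  assumes "additive_character (\<psi> :: 'a::finite_field \<Rightarrow> complex)"
  shows "norm (\<psi> x) = 1"
proof -
  have add: "\<psi> (x + y) = \<psi> x * \<psi> y" and nz: "\<psi> x \<noteq> 0" for x y
    using assms by (auto simp: additive_character_def)
  have "\<psi> (of_nat n * x) = \<psi> x ^ n" for n
  proof (induction n)
    case 0
    show ?case using add[of 0 0] nz[of 0] by simp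
  next
    case (Suc n)
    thus ?case by (simp add: distrib_right add)
  qed
  from this[of "CHAR('a)"] have "\<psi> x ^ CHAR('a) = 1"
    using add[of 0 0] nz[of 0] by simp
  hence "norm (\<psi> x) ^ CHAR('a) = 1 ^ CHAR('a)" by (simp flip: norm_power)
  thus ?thesis by (subst (asm) power_eq_iff_eq_base) auto
qed

lemma size_proots_alg_closed:
  fixes p :: "'b::alg_closed_field poly"
  shows "size (proots p) = Polynomial.degree p"
proof (cases "p = 0")
  case False
  then obtain A where A: "size A = Polynomial.degree p" "p = Polynomial.smult (Polynomial.lead_coeff p) (\<Prod>x\<in>#A. [:-x, 1:])"
    using alg_closed_imp_factorization by blast
  have "proots p = proots (\<Prod>x\<in>#A. [:-x, 1:])"
    by (subst A(2)) (use False in simp)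
  also have "\<dots> = A"
  proof (induction A)
    case (add x A)
    have "(\<Prod>x\<in>#A. [:-x, 1:]) \<noteq> 0" by (auto simp: prod_mset_zero_iff)
    thus ?case using add by (simp add: proots_mult del: mult_pCons_left)
  qed simp
  finally show ?thesis using A(1) by simp
qed simp

lemma map_poly_ring_hom_mult:
  fixes f :: "'b::comm_ring_1 \<Rightarrow> 'c::comm_ring_1"
  assumes "f 0 = 0" "\<And>x y. f (x + y) = f x + f y" "\<And>x y. f (x * y) = f x * f y"
  shows "map_poly f (p * r) = map_poly f p * map_poly f r"
proof (rule poly_eqI)
  fix n
  have sum: "f (\<Sum>i\<in>A. h i) = (\<Sum>i\<in>A. f (h i))" for h and A :: "nat set"
    by (induction A rule: infinite_finite_induct) (auto simp: assms)
  show "Polynomial.coeff (map_poly f (p * r)) n = Polynomial.coeff (map_poly f p * map_poly f r) n"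
    by (simp add: coeff_map_poly assms(1) coeff_mult sum assms(3))
qed

lemma CARD_finite_field_gt_1: "CARD('a::finite_field) > 1"
proof -
  have "card {0, 1 :: 'a} \<le> CARD('a)" by (intro card_mono) auto
  thus ?thesis by simp
qed

text \<open>
  The polynomial \<open>(X + 1)\<^sup>q - X\<^sup>q - 1\<close> has degree below \<open>q\<close> but vanishes on the whole field.
\<close>
lemma of_nat_CARD_choose_eq_0:
  assumes "0 < i" "i < CARD('a)"
  shows "of_nat (CARD('a) choose i) = (0 :: 'a::finite_field)"
proof -
  define q where "q = CARD('a)"
  have q1: "q > 1" using CARD_finite_field_gt_1 by (simp add: q_def)
  define F :: "'a poly" where "F = [:1, 1:] ^ q - Polynomial.monom 1 q - 1"
  have "poly F a = 0" for a
    using finite_field_power_card_eq_same[of a] finite_field_power_card_eq_same[of "1 + a"]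
    by (simp add: F_def poly_monom q_def)
  hence roots: "{x. poly F x = 0} = UNIV" by simp
  have "F = 0"
  proof (rule ccontr)
    assume "F \<noteq> 0"
    hence "q \<le> Polynomial.degree F" using card_poly_roots_bound[of F] roots by (simp add: q_def)
    moreover have "Polynomial.degree F \<le> q"
      unfolding F_def by (intro degree_diff_le) (auto simp: degree_power_eq degree_monom_eq)
    moreover have "Polynomial.coeff F q = 0"
      using q1 by (simp add: F_def coeff_linear_poly_power)
    ultimately show False using \<open>F \<noteq> 0\<close> by (metis le_antisym leading_coeff_0_iff)
  qed
  hence "Polynomial.coeff F i = 0" by simp
  thus ?thesis using assms by (simp add: F_def coeff_linear_poly_power q_def)
qed

lemma of_nat_CARD_choose_alg_closure_eq_0:
  assumes "0 < i" "i < CARD('a)"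
  shows "of_nat (CARD('a) choose i) = (0 :: 'a::finite_field alg_closure)"
  using of_nat_CARD_choose_eq_0[OF assms] by (metis to_ac_0 to_ac_of_nat)

text \<open>In the binomial expansion with exponent q, only the two outer terms have a coefficient
  that is nonzero in the closure.\<close>

lemma frobenius_add:
  fixes x y :: "'a::finite_field alg_closure"
  shows "(x + y) ^ CARD('a) = x ^ CARD('a) + y ^ CARD('a)"
proof -
  define q where "q = CARD('a)"
  have q1: "q > 1" using CARD_finite_field_gt_1 by (simp add: q_def)
  have "(x + y) ^ q = (\<Sum>i\<le>q. of_nat (q choose i) * x ^ i * y ^ (q - i))"
    by (rule binomial_ring)
  also have "\<dots> = (\<Sum>i\<in>{0, q}. of_nat (q choose i) * x ^ i * y ^ (q - i))"
    using of_nat_CARD_choose_alg_closure_eq_0[where ?'a = 'a]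
    by (intro sum.mono_neutral_right) (auto simp: q_def)
  also have "\<dots> = x ^ q + y ^ q" using q1 by simp
  finally show ?thesis by (simp add: q_def)
qed

lemma frobenius_power_add:
  fixes x y :: "'a::finite_field alg_closure"
  shows "(x + y) ^ (CARD('a) ^ d) = x ^ (CARD('a) ^ d) + y ^ (CARD('a) ^ d)"
proof (induction d)
  case (Suc d)
  thus ?case by (simp add: power_mult frobenius_add mult.commute[of "CARD('a)"])
qed simp

text \<open>Additivity at x + (-x) = 0 treats even and odd q alike.\<close>

lemma frobenius_power_uminus:
  fixes x :: "'a::finite_field alg_closure"
  shows "(- x) ^ (CARD('a) ^ d) = - (x ^ (CARD('a) ^ d))"
  using frobenius_power_add[of x "-x" d] CARD_finite_field_gt_1[where ?'a = 'a]
  by (simp add: add_eq_0_iff power_0_left)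

lemma frobenius_power_diff:
  fixes x y :: "'a::finite_field alg_closure"
  shows "(x - y) ^ (CARD('a) ^ d) = x ^ (CARD('a) ^ d) - y ^ (CARD('a) ^ d)"
  using frobenius_power_add[of x "-y" d] by (simp add: frobenius_power_uminus)

lemma frobenius_power_inject:
  fixes x y :: "'a::finite_field alg_closure"
  shows "x ^ (CARD('a) ^ d) = y ^ (CARD('a) ^ d) \<longleftrightarrow> x = y"
  using frobenius_power_diff[of x y d] by auto

lemma frobenius_power_sum:
  fixes h :: "'i \<Rightarrow> 'a::finite_field alg_closure"
  shows "(\<Sum>i\<in>A. h i) ^ (CARD('a) ^ d) = (\<Sum>i\<in>A. h i ^ (CARD('a) ^ d))"
  using CARD_finite_field_gt_1[where ?'a = 'a]
  by (induction A rule: infinite_finite_induct) (auto simp: frobenius_power_add power_0_left)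

section \<open>Finite subfields of the closure and their traces\<close>

definition ac_subfield :: "nat \<Rightarrow> 'a::finite_field alg_closure set" where
  "ac_subfield d = {x. x ^ (CARD('a) ^ d) = x}"

text \<open>With Q = q^d, the polynomial X^Q - X has derivative -1, so its Q roots are distinct. At
  d = 0 the defining equation of \<open>ac_subfield\<close> holds on the whole closure.\<close>

lemma card_ac_subfield:
  assumes "d > 0"
  shows "finite (ac_subfield d :: 'a::finite_field alg_closure set)"
    and "card (ac_subfield d :: 'a alg_closure set) = CARD('a) ^ d"
proof -
  define Q where "Q = CARD('a) ^ d"
  define P :: "'a alg_closure poly" where "P = Polynomial.monom 1 Q - [:0, 1:]"
  have Q1: "Q > 1" using one_less_power[OF CARD_finite_field_gt_1[where ?'a = 'a] assms] by (simp add: Q_def)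
  have deg: "Polynomial.degree P = Q"
  proof (rule antisym)
    show "Polynomial.degree P \<le> Q"
      unfolding P_def using Q1 by (intro degree_diff_le) (auto simp: degree_monom_eq)
    have "Polynomial.coeff P Q = 1" using Q1 by (simp add: P_def coeff_pCons split: nat.splits)
    thus "Q \<le> Polynomial.degree P" by (intro le_degree) simp
  qed
  hence P0: "P \<noteq> 0" using Q1 by auto
  have F: "ac_subfield d = {x. poly P x = 0}"
    by (auto simp: ac_subfield_def P_def poly_monom Q_def)
  show fin: "finite (ac_subfield d :: 'a alg_closure set)" unfolding F by (rule poly_roots_finite[OF P0])
  have "of_nat CARD('a) = (0 :: 'a alg_closure)"
    using of_nat_CARD_choose_alg_closure_eq_0[of 1, where ?'a = 'a] CARD_finite_field_gt_1[where ?'a = 'a] by simp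
  hence "of_nat Q = (0 :: 'a alg_closure)" using assms by (simp add: Q_def)
  hence pd: "pderiv P = [:-1:]" by (simp add: P_def pderiv_diff pderiv_monom pderiv_pCons)
  have ord: "Polynomial.order x P = 1" if "poly P x = 0" for x
  proof -
    have "\<not> [:-x, 1:] ^ 2 dvd P"
    proof
      assume "[:-x, 1:] ^ 2 dvd P"
      then obtain r where "P = [:-x, 1:] ^ 2 * r" by (elim dvdE)
      hence "P = [:-x, 1:] * ([:-x, 1:] * r)" by (simp only: power2_eq_square mult.assoc)
      hence "poly (pderiv P) x = 0" by (simp add: pderiv_mult del: mult_pCons_left)
      thus False unfolding pd by simp
    qed
    moreover have "Polynomial.order x P > 0" using that P0 by (simp add: order_gt_0_iff)
    ultimately show ?thesis using P0 by (simp add: order_divides)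
  qed
  have "Q = size (proots P)" by (simp add: size_proots_alg_closed deg)
  also have "\<dots> = (\<Sum>x\<in>set_mset (proots P). count (proots P) x)" by (rule size_multiset_overloaded_eq)
  also have "\<dots> = (\<Sum>x\<in>{x. poly P x = 0}. 1)"
    using P0 ord by (intro sum.cong) auto
  also have "\<dots> = card (ac_subfield d :: 'a alg_closure set)" unfolding F by simp
  finally show "card (ac_subfield d :: 'a alg_closure set) = CARD('a) ^ d" by (simp add: Q_def)
qed

text \<open>The image of the base field consists of roots of X^q - X and already has q elements, so
  it contains all of them.\<close>

lemma range_to_ac_iff:
  fixes x :: "'a::finite_field alg_closure"
  shows "x \<in> range to_ac \<longleftrightarrow> x ^ CARD('a) = x"
proof -
  have "range to_ac = (ac_subfield 1 :: 'a alg_closure set)"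
  proof (rule card_subset_eq)
    show "range to_ac \<subseteq> (ac_subfield 1 :: 'a alg_closure set)"
      by (auto simp: ac_subfield_def finite_field_power_card_eq_same simp flip: to_ac_power)
    show "card (range to_ac :: 'a alg_closure set) = card (ac_subfield 1 :: 'a alg_closure set)"
      using card_image[OF inj_to_ac[where ?'a = 'a]] by (simp add: card_ac_subfield)
  qed (simp add: card_ac_subfield)
  thus ?thesis by (simp add: ac_subfield_def)
qed

text \<open>Elements fixed by Frobenius lie in the image of \<open>to_ac\<close>, where
  \<open>of_ac\<close> inverts an additive map.\<close>

lemma of_ac_add:
  fixes x y :: "'a::finite_field alg_closure"
  assumes "x ^ CARD('a) = x" "y ^ CARD('a) = y"
  shows "of_ac (x + y) = of_ac x + of_ac y"
proof -
  have "x \<in> range to_ac" "y \<in> range to_ac" using assms by (simp_all add: range_to_ac_iff)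
  thus ?thesis by (metis of_ac_to_ac rangeE to_ac_add)
qed

text \<open>On \<open>ac_subfield d\<close> this is the trace down to the base field, with its value
  kept inside the closure.\<close>

definition ac_trace :: "nat \<Rightarrow> 'a::finite_field alg_closure \<Rightarrow> 'a alg_closure" where
  "ac_trace d y = (\<Sum>i<d. y ^ (CARD('a) ^ i))"

lemma ac_trace_add: "ac_trace d (x + y) = ac_trace d x + ac_trace d y"
  by (simp add: ac_trace_def frobenius_power_add sum.distrib)

text \<open>Raising to the power q shifts the terms by one place, and the last one returns to
  y.\<close>

lemma ac_trace_fixed:
  fixes y :: "'a::finite_field alg_closure"
  assumes "y \<in> ac_subfield d"
  shows "ac_trace d y ^ CARD('a) = ac_trace d y"
proof -
  have "ac_trace d y ^ CARD('a) = (\<Sum>i<d. y ^ (CARD('a) ^ Suc i))"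
    using frobenius_power_sum[of "\<lambda>i. y ^ (CARD('a) ^ i)" "{..<d}" 1]
    by (simp add: ac_trace_def mult.commute flip: power_mult)
  also have "\<dots> = (\<Sum>i<Suc d. y ^ (CARD('a) ^ i)) - y"
    by (subst sum.lessThan_Suc_shift) simp
  also have "\<dots> = ac_trace d y"
    using assms by (simp add: ac_trace_def ac_subfield_def)
  finally show ?thesis .
qed

lemma ac_trace_scale:
  fixes y c :: "'a::finite_field alg_closure"
  assumes "c ^ CARD('a) = c"
  shows "ac_trace d (c * y) = c * ac_trace d y"
proof -
  have "c ^ (CARD('a) ^ i) = c" for i by (induction i) (use assms in \<open>auto simp: power_mult\<close>)
  thus ?thesis by (simp add: ac_trace_def power_mult_distrib sum_distrib_left)
qed

text \<open>The trace is a nonzero polynomial of degree at most q^(d-1), so it cannot vanish at all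
  q^d elements of the subfield.\<close>

lemma ac_trace_nonzero:
  assumes "d > 0"
  obtains y :: "'a::finite_field alg_closure" where "y \<in> ac_subfield d" "ac_trace d y \<noteq> 0"
proof -
  define q where "q = CARD('a)"
  have q1: "q > 1" using CARD_finite_field_gt_1 by (simp add: q_def)
  define T :: "'a alg_closure poly" where "T = (\<Sum>i<d. Polynomial.monom 1 (q ^ i))"
  have T: "poly T y = ac_trace d y" for y by (simp add: T_def ac_trace_def poly_sum poly_monom q_def)
  have inj: "q ^ i = q ^ j \<longleftrightarrow> i = j" for i j using q1 by (simp add: power_inject_exp)
  have "Polynomial.coeff T (q ^ 0) = (\<Sum>i<d. if i = 0 then 1 else 0)"
    unfolding T_def coeff_sum coeff_monom inj ..
  hence T0: "T \<noteq> 0" using assms by auto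
  have "Polynomial.degree T \<le> q ^ (d - 1)"
    unfolding T_def using q1 by (intro degree_sum_le) (auto simp: degree_monom_eq intro!: power_increasing)
  hence "card {y. poly T y = 0} \<le> q ^ (d - 1)" using card_poly_roots_bound[OF T0] by linarith
  also have "\<dots> < q ^ d" using assms q1 by (intro power_strict_increasing) auto
  also have "\<dots> = card (ac_subfield d :: 'a alg_closure set)" using assms by (simp add: card_ac_subfield q_def)
  finally have "\<not> ac_subfield d \<subseteq> {y. poly T y = 0}"
    using card_mono[OF poly_roots_finite[OF T0]] by (metis leD)
  thus ?thesis using that T by auto
qed

lemma trace_character_sum_bound:
  fixes \<psi> :: "'a::finite_field \<Rightarrow> complex"
  assumes "additive_character \<psi>" "\<exists>x. \<psi> x \<noteq> 1" "d > 0"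
  shows "norm (\<Sum>x\<in>ac_subfield d - {0}. \<psi> (of_ac (ac_trace d (x ^ k))))
     \<le> real (gcd k (CARD('a) ^ d - 1)) * sqrt (real (CARD('a) ^ d))"
proof -
  let ?F = "ac_subfield d :: 'a alg_closure set"
  obtain a where a: "\<psi> a \<noteq> 1" using assms(2) by blast
  obtain y0 :: "'a alg_closure" where y0: "y0 \<in> ac_subfield d" "ac_trace d y0 \<noteq> 0"
    using ac_trace_nonzero[OF assms(3)] .
  \<comment> \<open>c lies in the base field, so by linearity \<open>c * y0\<close> has trace a, and
    \<psi> composed with the trace is nontrivial there.\<close>
  define c where "c = to_ac a / ac_trace d y0"
  have c: "c ^ CARD('a) = c"
    using ac_trace_fixed[OF y0(1)] by (simp add: c_def power_divide finite_field_power_card_eq_same flip: to_ac_power)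
  have cd: "c ^ (CARD('a) ^ i) = c" for i by (induction i) (use c in \<open>auto simp: power_mult\<close>)
  have card: "finite ?F" "card ?F = CARD('a) ^ d" using assms(3) by (simp_all add: card_ac_subfield)
  have "norm (\<Sum>x\<in>?F-{0}. (\<lambda>y. \<psi> (of_ac (ac_trace d y))) (x ^ k)) \<le> real (gcd k (card ?F - 1)) * sqrt (real (card ?F))"
  proof (rule power_character_sum_bound)
    show "card ?F > 1" using card one_less_power[OF CARD_finite_field_gt_1[where ?'a = 'a] assms(3)] by simp
    show "c * y0 \<in> ?F" using y0 cd by (simp add: ac_subfield_def power_mult_distrib)
    have "ac_trace d (c * y0) = to_ac a"
      unfolding ac_trace_scale[OF c] using y0 by (simp add: c_def)
    thus "\<psi> (of_ac (ac_trace d (c * y0))) \<noteq> 1" using a by simp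
    show "\<psi> (of_ac (ac_trace d (x + y))) = \<psi> (of_ac (ac_trace d x)) * \<psi> (of_ac (ac_trace d y))"
      if "x \<in> ?F" "y \<in> ?F" for x y
      using assms(1) that by (simp add: ac_trace_add of_ac_add ac_trace_fixed additive_character_def)
    show "x ^ card ?F = x" if "x \<in> ?F" for x using that card by (simp add: ac_subfield_def)
  qed (use card norm_additive_character[OF assms(1)] in
        \<open>auto simp: ac_subfield_def frobenius_power_diff power_mult_distrib power_divide\<close>)
  thus ?thesis using card by simp
qed

section \<open>Polynomials fixed by Frobenius\<close>

definition frob_poly :: "'a::finite_field alg_closure poly \<Rightarrow> 'a alg_closure poly" where
  "frob_poly p = map_poly (\<lambda>c. c ^ CARD('a)) p"

lemma frob_poly_mult: "frob_poly (p * r) = frob_poly p * frob_poly (r :: 'a::finite_field alg_closure poly)"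
  unfolding frob_poly_def
  by (rule map_poly_ring_hom_mult) (auto simp: frobenius_add power_mult_distrib)

lemma frob_poly_1 [simp]: "frob_poly (1 :: 'a::finite_field alg_closure poly) = 1"
  by (simp add: frob_poly_def map_poly_1)

lemma frob_poly_power: "frob_poly (p ^ n) = frob_poly (p :: 'a::finite_field alg_closure poly) ^ n"
  by (induction n) (auto simp: frob_poly_mult)

lemma frob_poly_prod: "frob_poly (\<Prod>i\<in>A. h i) = (\<Prod>i\<in>A. frob_poly (h i :: 'a::finite_field alg_closure poly))"
  by (induction A rule: infinite_finite_induct) (auto simp: frob_poly_mult)

lemma frob_poly_linear:
  "frob_poly [:- x, 1:] = [:- (x ^ CARD('a)), 1 :: 'a::finite_field alg_closure:]"
  using frobenius_power_uminus[of x 1]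
  by (simp add: frob_poly_def map_poly_pCons)

text \<open>Applying Frobenius to the coefficients of p = (X - x)^m s fixes p and turns the first
  factor into the m-th power of X - x^q.\<close>

lemma order_le_order_frobenius:
  fixes p :: "'a::finite_field alg_closure poly"
  assumes "frob_poly p = p" "p \<noteq> 0"
  shows "Polynomial.order x p \<le> Polynomial.order (x ^ CARD('a)) p"
proof -
  obtain s where s: "p = [:- x, 1:] ^ Polynomial.order x p * s"
    using order_1[of x p] by (elim dvdE)
  have "frob_poly p = [:- (x ^ CARD('a)), 1:] ^ Polynomial.order x p * frob_poly s"
    by (subst s) (simp add: frob_poly_mult frob_poly_power frob_poly_linear)
  hence "[:- (x ^ CARD('a)), 1:] ^ Polynomial.order x p dvd p" using assms(1) by (metis dvd_triv_left)
  thus ?thesis using assms(2) by (simp add: order_divides)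
qed

lemma order_le_order_frobenius_power:
  fixes p :: "'a::finite_field alg_closure poly"
  assumes "frob_poly p = p" "p \<noteq> 0"
  shows "Polynomial.order x p \<le> Polynomial.order (x ^ (CARD('a) ^ i)) p"
proof (induction i)
  case (Suc i)
  note Suc
  also have "Polynomial.order (x ^ (CARD('a) ^ i)) p \<le> Polynomial.order ((x ^ (CARD('a) ^ i)) ^ CARD('a)) p"
    by (rule order_le_order_frobenius[OF assms])
  finally show ?case by (simp add: mult.commute flip: power_mult)
qed simp

lemma image_proots_frobenius:
  fixes p :: "'a::finite_field alg_closure poly"
  assumes "frob_poly p = p" "p \<noteq> 0"
  shows "image_mset (\<lambda>x. x ^ CARD('a)) (proots p) = proots p"
proof -
  have inj: "inj (\<lambda>x :: 'a alg_closure. x ^ CARD('a))"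
    using frobenius_power_inject[of _ 1] by (intro injI) auto
  have count_image_inj: "count (image_mset (\<lambda>x. x ^ CARD('a)) (proots p)) (x ^ CARD('a)) = count (proots p) x" for x
  proof -
    have "{z \<in> set_mset (proots p). x ^ CARD('a) = z ^ CARD('a)} = (if x \<in># proots p then {x} else {})"
      using inj by (auto dest: injD)
    thus ?thesis by (auto simp: count_image_mset' not_in_iff)
  qed
  have "image_mset (\<lambda>x. x ^ CARD('a)) (proots p) \<subseteq># proots p"
  proof (rule mset_subset_eqI)
    fix y
    show "count (image_mset (\<lambda>x. x ^ CARD('a)) (proots p)) y \<le> count (proots p) y"
    proof (cases "\<exists>x. y = x ^ CARD('a)")
      case True
      then obtain x where y: "y = x ^ CARD('a)" by blast
      show ?thesis unfolding y using order_le_order_frobenius[OF assms, of x] assms(2)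
        by (simp add: count_image_inj)
    next
      case False
      hence "y \<notin># image_mset (\<lambda>x. x ^ CARD('a)) (proots p)" by auto
      hence "count (image_mset (\<lambda>x. x ^ CARD('a)) (proots p)) y = 0" by (simp only: not_in_iff)
      thus ?thesis by simp
    qed
  qed
  \<comment> \<open>Both multisets have the same size, so the inclusion is an equality.\<close>
  thus ?thesis
    using mset_subset_size subset_mset.le_imp_less_or_eq by fastforce
qed


section \<open>Monic polynomials over the base field, seen in the closure\<close>

definition monic_fixed :: "nat \<Rightarrow> 'a::finite_field alg_closure poly set" where
  "monic_fixed n = {p. Polynomial.degree p = n \<and> Polynomial.lead_coeff p = 1 \<and> frob_poly p = p}"

lemma monic_fixed_nonzero: "p \<in> monic_fixed n \<Longrightarrow> p \<noteq> 0"
  by (auto simp: monic_fixed_def)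

text \<open>Invariance under \<open>frob_poly\<close> means that each coefficient is fixed by
  Frobenius, hence lies in the image of \<open>to_ac\<close>.\<close>

lemma bij_betw_map_poly_to_ac:
  "bij_betw (map_poly to_ac) (monic_polys n :: 'a::finite_field poly set) (monic_fixed n)"
proof (rule bij_betwI[of _ _ _ "map_poly of_ac"])
  have deg: "Polynomial.degree (map_poly to_ac f) = Polynomial.degree f" for f :: "'a poly"
    by (rule degree_map_poly) auto
  show "map_poly to_ac \<in> monic_polys n \<rightarrow> (monic_fixed n :: 'a alg_closure poly set)"
  proof
    fix f :: "'a poly" assume "f \<in> monic_polys n"
    moreover have "frob_poly (map_poly to_ac f) = map_poly to_ac f"
      unfolding frob_poly_def
      by (rule poly_eqI) (simp add: coeff_map_poly finite_field_power_card_eq_same flip: to_ac_power)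
    ultimately show "map_poly to_ac f \<in> monic_fixed n"
      by (auto simp: monic_fixed_def monic_polys_def deg coeff_map_poly)
  qed
  show inv: "map_poly of_ac (map_poly to_ac f) = f" for f :: "'a poly"
    by (rule poly_eqI) (simp add: coeff_map_poly)
  have inv': "map_poly to_ac (map_poly of_ac p) = p" if "p \<in> monic_fixed n" for p :: "'a alg_closure poly"
  proof (rule poly_eqI)
    fix i
    have "Polynomial.coeff p i ^ CARD('a) = Polynomial.coeff (frob_poly p) i"
      by (simp add: frob_poly_def coeff_map_poly)
    also have "\<dots> = Polynomial.coeff p i" using that by (simp add: monic_fixed_def)
    finally have "Polynomial.coeff p i \<in> range to_ac" by (simp add: range_to_ac_iff)
    thus "Polynomial.coeff (map_poly to_ac (map_poly of_ac p)) i = Polynomial.coeff p i"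
      by (simp add: coeff_map_poly to_ac_of_ac)
  qed
  show "map_poly to_ac (map_poly of_ac p) = p" if "p \<in> monic_fixed n" for p :: "'a alg_closure poly"
    using that by (rule inv')
  show "map_poly of_ac \<in> monic_fixed n \<rightarrow> (monic_polys n :: 'a poly set)"
  proof
    fix p :: "'a alg_closure poly" assume p: "p \<in> monic_fixed n"
    have "Polynomial.degree (map_poly of_ac p) = n"
      using inv'[OF p] deg[of "map_poly of_ac p"] p by (simp add: monic_fixed_def)
    moreover have "of_ac 1 = (1 :: 'a)" by (rule of_ac_eqI) simp
    ultimately show "map_poly of_ac p \<in> monic_polys n"
      using p by (auto simp: monic_polys_def monic_fixed_def coeff_map_poly)
  qed
qed

lemma card_monic_polys_le:
  "finite (monic_polys n :: 'a::finite_field poly set)"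
  "card (monic_polys n :: 'a poly set) \<le> CARD('a) ^ n"
proof -
  define h :: "'a poly \<Rightarrow> nat \<Rightarrow> 'a" where "h f = restrict (Polynomial.coeff f) {..<n}" for f
  have inj: "inj_on h (monic_polys n)"
  proof (rule inj_onI)
    fix f g :: "'a poly" assume fg: "f \<in> monic_polys n" "g \<in> monic_polys n" "h f = h g"
    show "f = g"
    proof (rule poly_eqI)
      fix i
      consider "i < n" | "i = n" | "i > n" by linarith
      thus "Polynomial.coeff f i = Polynomial.coeff g i"
      proof cases
        case 1
        thus ?thesis using fun_cong[OF fg(3), of i] by (simp add: h_def)
      next
        case 2
        thus ?thesis using fg by (auto simp: monic_polys_def)
      next
        case 3
        thus ?thesis using fg by (simp add: monic_polys_def coeff_eq_0)
      qed
    qed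
  qed
  have sub: "h ` monic_polys n \<subseteq> {..<n} \<rightarrow>\<^sub>E UNIV" unfolding h_def by (intro image_subsetI) (simp only: restrict_PiE_iff UNIV_I ball_triv simp_thms)
  have fin: "finite ({..<n} \<rightarrow>\<^sub>E (UNIV :: 'a set))" by (intro finite_PiE) auto
  show "finite (monic_polys n :: 'a poly set)"
    using inj sub fin by (metis finite_imageD finite_subset)
  show "card (monic_polys n :: 'a poly set) \<le> CARD('a) ^ n"
    using card_inj_on_le[OF inj sub fin] by (simp add: card_PiE)
qed

lemma card_monic_fixed_le:
  "finite (monic_fixed n :: 'a::finite_field alg_closure poly set)"
  "card (monic_fixed n :: 'a alg_closure poly set) \<le> CARD('a) ^ n"
  using bij_betw_finite[OF bij_betw_map_poly_to_ac[of n, where ?'a = 'a]]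
    bij_betw_same_card[OF bij_betw_map_poly_to_ac[of n, where ?'a = 'a]]
    card_monic_polys_le[of n, where ?'a = 'a] by simp_all

text \<open>\<open>frob_poly\<close> is multiplicative and p can be cancelled. This parametrises the
  fixed monic multiples of p by their cofactors.\<close>

lemma monic_fixed_mult_iff:
  fixes p r :: "'a::finite_field alg_closure poly"
  assumes "p \<in> monic_fixed d"
  shows "p * r \<in> monic_fixed n \<longleftrightarrow> d \<le> n \<and> r \<in> monic_fixed (n - d)"
proof (cases "r = 0")
  case True
  thus ?thesis by (simp add: monic_fixed_def)
next
  case False
  have p: "p \<noteq> 0" "frob_poly p = p" "Polynomial.degree p = d" "Polynomial.lead_coeff p = 1"
    using assms by (auto simp: monic_fixed_def)
  have "frob_poly (p * r) = p * r \<longleftrightarrow> frob_poly r = r"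
    using p by (simp add: frob_poly_mult)
  moreover have "Polynomial.degree (p * r) = d + Polynomial.degree r"
    using p False by (simp add: degree_mult_eq)
  moreover have "Polynomial.lead_coeff (p * r) = Polynomial.lead_coeff r"
    using p by (simp only: lead_coeff_mult mult_1)
  ultimately show ?thesis by (auto simp: monic_fixed_def)
qed

section \<open>The character on fixed polynomials\<close>

definition root_power_sum :: "nat \<Rightarrow> 'a::finite_field alg_closure poly \<Rightarrow> 'a alg_closure" where
  "root_power_sum k p = (\<Sum>x\<in>#proots p. inverse x ^ k)"

text \<open>Frobenius permutes the roots together with their multiplicities, so the power sum lies
  in the base field and \<open>of_ac\<close> recovers it faithfully.\<close>

lemma root_power_sum_fixed:
  fixes p :: "'a::finite_field alg_closure poly"
  assumes "p \<in> monic_fixed n"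
  shows "root_power_sum k p ^ CARD('a) = root_power_sum k p"
proof -
  have sum: "(\<Sum>x\<in>#M. h x) ^ CARD('a) = (\<Sum>x\<in>#M. h x ^ CARD('a))" for M and h :: "'a alg_closure \<Rightarrow> 'a alg_closure"
    by (induction M) (auto simp: frobenius_add)
  have "root_power_sum k p ^ CARD('a) = (\<Sum>x\<in>#proots p. (inverse x ^ k) ^ CARD('a))"
    unfolding root_power_sum_def by (rule sum)
  also have "\<dots> = (\<Sum>x\<in>#image_mset (\<lambda>x. x ^ CARD('a)) (proots p). inverse x ^ k)"
    by (simp add: image_mset.compositionality o_def power_inverse mult.commute flip: power_mult)
  also have "\<dots> = root_power_sum k p"
    using assms monic_fixed_nonzero[OF assms] by (subst image_proots_frobenius) (auto simp: root_power_sum_def monic_fixed_def)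
  finally show ?thesis .
qed

definition ac_chi :: "nat \<Rightarrow> ('a::finite_field \<Rightarrow> complex) \<Rightarrow> 'a alg_closure poly \<Rightarrow> complex" where
  "ac_chi k \<psi> p = (if poly p 0 = 0 then 0 else \<psi> (of_ac (root_power_sum k p)))"

text \<open>X is a prime element, so coprimality with X amounts to a nonzero value at 0.\<close>

lemma chi_eq_ac_chi: "chi k \<psi> f = ac_chi k \<psi> (map_poly to_ac f)"
proof -
  have "coprime f [:0, 1:] \<longleftrightarrow> \<not> [:0, 1:] dvd f"
  proof
    assume "coprime f [:0, 1:]"
    thus "\<not> [:0, 1:] dvd f"
      using not_coprimeI[of "[:0, 1:]" f "[:0, 1:]"] by (auto simp: is_unit_iff_degree)
  next
    assume "\<not> [:0, 1:] dvd f"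
    show "coprime f [:0, 1:]"
    proof (rule coprimeI)
      fix d assume d: "d dvd f" "d dvd [:0, 1:]"
      then obtain u where u: "[:0, 1:] = d * u" by (elim dvdE)
      hence "[:0, 1:] dvd d \<or> [:0, 1:] dvd u"
        using prime_elem_linear_field_poly[of "1 :: 'a" 0] by (metis dvd_refl one_neq_zero prime_elem_dvd_mult_iff)
      moreover have "\<not> [:0, 1:] dvd d" using d \<open>\<not> [:0, 1:] dvd f\<close> dvd_trans by blast
      ultimately obtain v where "u = [:0, 1:] * v" by (meson dvdE)
      hence "[:0, 1:] * (d * v) = [:0, 1:] * 1" using u by (metis mult.left_commute mult.right_neutral)
      hence "d * v = 1" by (subst (asm) mult_cancel_left) auto
      thus "is_unit d" by (metis dvd_triv_left)
    qed
  qed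
  also have "[:0, 1:] dvd f \<longleftrightarrow> poly f 0 = 0"
    using poly_eq_0_iff_dvd[of f 0] by simp
  also have "poly f 0 = 0 \<longleftrightarrow> poly (map_poly to_ac f) 0 = 0"
    by (simp add: poly_0_coeff_0 coeff_map_poly)
  finally show ?thesis
    by (simp add: chi_def ac_chi_def neg_power_sum_def root_power_sum_def)
qed

text \<open>The root multiset of a product is the sum of the root multisets, and \<psi> turns the
  resulting sum of power sums into a product.\<close>

lemma ac_chi_mult:
  fixes \<psi> :: "'a::finite_field \<Rightarrow> complex"
  assumes "additive_character \<psi>" "p \<in> monic_fixed m" "r \<in> monic_fixed n"
  shows "ac_chi k \<psi> (p * r) = ac_chi k \<psi> p * ac_chi k \<psi> r"
proof -
  have "root_power_sum k (p * r) = root_power_sum k p + root_power_sum k r"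
    using assms(2,3)[THEN monic_fixed_nonzero] by (simp add: root_power_sum_def proots_mult)
  hence "of_ac (root_power_sum k (p * r)) = of_ac (root_power_sum k p) + of_ac (root_power_sum k r)"
    using assms by (simp add: of_ac_add root_power_sum_fixed)
  thus ?thesis using assms(1) by (simp add: ac_chi_def additive_character_def)
qed

lemma norm_ac_chi_le:
  assumes "additive_character \<psi>"
  shows "norm (ac_chi k \<psi> p) \<le> 1"
  using norm_additive_character[OF assms] by (simp add: ac_chi_def)

section \<open>Characteristic polynomials of Frobenius orbits\<close>

definition frob_norm :: "nat \<Rightarrow> 'a::finite_field alg_closure \<Rightarrow> 'a alg_closure poly" where
  "frob_norm d x = (\<Prod>i<d. [:- (x ^ (CARD('a) ^ i)), 1:])"

lemma proots_frob_norm: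
  "proots (frob_norm d x) = mset (map (\<lambda>i. x ^ (CARD('a) ^ i)) [0..<d])"
  for x :: "'a::finite_field alg_closure"
proof (induction d)
  case (Suc d)
  have "frob_norm d x \<noteq> 0" by (simp add: frob_norm_def)
  hence "proots (frob_norm (Suc d) x) = proots (frob_norm d x) + {#x ^ (CARD('a) ^ d)#}"
    unfolding frob_norm_def prod.lessThan_Suc by (subst proots_mult) auto
  thus ?case using Suc by simp
qed (simp add: frob_norm_def)

text \<open>For x in the field with q^d elements, \<open>frob_norm d x\<close> is the characteristic
  polynomial of x over the base field; Frobenius permutes its linear factors cyclically.\<close>

lemma frob_norm_monic_fixed:
  fixes x :: "'a::finite_field alg_closure"
  assumes "x \<in> ac_subfield d"
  shows "frob_norm d x \<in> monic_fixed d"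
proof -
  have "frob_poly (frob_norm d x) = (\<Prod>i<d. [:- (x ^ (CARD('a) ^ Suc i)), 1:])"
    by (simp add: frob_norm_def frob_poly_prod frob_poly_linear mult.commute flip: power_mult)
  also have "\<dots> = frob_norm d x"
  proof (cases d)
    case (Suc m)
    have "(\<Prod>i<d. [:- (x ^ (CARD('a) ^ Suc i)), 1:]) = (\<Prod>i<m. [:- (x ^ (CARD('a) ^ Suc i)), 1:]) * [:- x, 1:]"
      using assms unfolding Suc prod.lessThan_Suc by (simp only: ac_subfield_def Suc mem_Collect_eq)
    also have "\<dots> = frob_norm d x"
      unfolding frob_norm_def Suc prod.lessThan_Suc_shift by (simp add: mult.commute)
    finally show ?thesis .
  qed (simp add: frob_norm_def)
  finally have "frob_poly (frob_norm d x) = frob_norm d x" .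
  moreover have "Polynomial.degree (frob_norm d x) = d"
    using size_proots_alg_closed[of "frob_norm d x"] by (simp add: proots_frob_norm)
  moreover have "Polynomial.lead_coeff (frob_norm d x) = 1"
    unfolding frob_norm_def by (subst lead_coeff_prod) auto
  ultimately show ?thesis by (simp add: monic_fixed_def)
qed

lemma frob_norm_add:
  "frob_norm (a + b) x = frob_norm a x * frob_norm b (x ^ (CARD('a) ^ a))"
  for x :: "'a::finite_field alg_closure"
proof (induction b)
  case (Suc b)
  have "x ^ (CARD('a) ^ (a + b)) = (x ^ (CARD('a) ^ a)) ^ (CARD('a) ^ b)"
    by (simp add: power_add power_mult)
  thus ?case using Suc by (simp add: frob_norm_def mult.assoc del: mult_pCons_left mult_pCons_right)
qed (simp add: frob_norm_def)

text \<open>After every e factors the orbit is back at x, so the product splits into j equal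
  blocks.\<close>

lemma frob_norm_mult_period:
  assumes "x \<in> ac_subfield e"
  shows "frob_norm (e * j) x = frob_norm e x ^ j"
proof (induction j)
  case (Suc j)
  thus ?case using assms by (simp add: frob_norm_add ac_subfield_def)
qed (simp add: frob_norm_def)

text \<open>The roots are the conjugates of x, listed d times in all, so their power sum of exponent
  -k is the trace of x^(-k). This links the polynomial side to the character sums.\<close>

lemma ac_chi_frob_norm:
  fixes x :: "'a::finite_field alg_closure"
  assumes "x \<noteq> 0"
  shows "ac_chi k \<psi> (frob_norm d x) = \<psi> (of_ac (ac_trace d (inverse x ^ k)))"
proof -
  have "root_power_sum k (frob_norm d x) = sum_list (map (\<lambda>i. inverse (x ^ (CARD('a) ^ i)) ^ k) [0..<d])"
    unfolding root_power_sum_def proots_frob_norm mset_map[symmetric] sum_mset_sum_list map_map o_def ..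
  also have "\<dots> = (\<Sum>i<d. inverse (x ^ (CARD('a) ^ i)) ^ k)"
    by (simp add: interv_sum_list_conv_sum_set_nat atLeast0LessThan)
  also have "\<dots> = ac_trace d (inverse x ^ k)"
    by (simp add: ac_trace_def power_inverse mult.commute flip: power_mult)
  finally show ?thesis using assms by (simp add: ac_chi_def frob_norm_def poly_prod)
qed

lemma prod_dvd_if_pairwise_coprime:
  fixes h :: "'i \<Rightarrow> 'b::semiring_gcd"
  assumes "finite I" "\<And>i. i \<in> I \<Longrightarrow> h i dvd c" "\<And>i j. i \<in> I \<Longrightarrow> j \<in> I \<Longrightarrow> i \<noteq> j \<Longrightarrow> coprime (h i) (h j)"
  shows "(\<Prod>i\<in>I. h i) dvd c"
  using assms
proof (induction I)
  case (insert i I)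
  have "coprime (h i) (\<Prod>i\<in>I. h i)"
    using insert by (intro prod_coprime_right) auto
  thus ?case using insert by (auto intro!: divides_mult)
qed auto

text \<open>Let e be the least period of x under Frobenius. Then x lies in
  \<open>ac_subfield d\<close> exactly for d = e j, and \<open>frob_norm (e * j) x\<close> is the
  j-th power of the minimal polynomial of x, which divides p exactly when j is at most the
  multiplicity of x. Counting d is thus counting j.\<close>

lemma order_eq_card_frob_norm_dvd:
  fixes p :: "'a::finite_field alg_closure poly"
  assumes p: "p \<in> monic_fixed n"
  shows "Polynomial.order x p = card {d\<in>{1..n}. x \<in> ac_subfield d \<and> frob_norm d x dvd p}"
proof -
  have p0: "p \<noteq> 0" and fixd: "frob_poly p = p" and deg: "Polynomial.degree p = n"
    using p monic_fixed_nonzero by (auto simp: monic_fixed_def)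
  have lin: "[:- x, 1:] dvd frob_norm d x" if "d > 0" for d
    using that dvd_prodI[of "{..<d}" 0 "\<lambda>i. [:- (x ^ (CARD('a) ^ i)), 1:]"] by (simp add: frob_norm_def)
  show ?thesis
  proof (cases "Polynomial.order x p = 0")
    case True
    hence "\<not> [:- x, 1:] dvd p" using p0 order_root poly_eq_0_iff_dvd by metis
    hence "{d\<in>{1..n}. x \<in> ac_subfield d \<and> frob_norm d x dvd p} = {}"
      using lin dvd_trans by (auto simp: Suc_le_eq)
    thus ?thesis using True by simp
  next
    case False
    \<comment> \<open>All Frobenius iterates of a root of p are roots, so there are finitely many
      and the orbit must repeat.\<close>
    have "range (\<lambda>i. x ^ (CARD('a) ^ i)) \<subseteq> {y. poly p y = 0}"
    proof clarify
      fix i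
      have "Polynomial.order (x ^ (CARD('a) ^ i)) p \<noteq> 0"
        using order_le_order_frobenius_power[OF fixd p0, of x i] False by linarith
      thus "poly p (x ^ (CARD('a) ^ i)) = 0" using order_root by blast
    qed
    hence "finite (range (\<lambda>i. x ^ (CARD('a) ^ i)))" using poly_roots_finite[OF p0] finite_subset by blast
    hence "\<not> inj (\<lambda>i. x ^ (CARD('a) ^ i))" using finite_imageD infinite_UNIV_nat by blast
    then obtain i0 j0 where "i0 \<noteq> j0" "x ^ (CARD('a) ^ i0) = x ^ (CARD('a) ^ j0)"
      by (auto simp: inj_def)
    then obtain i j where ij: "i < j" "x ^ (CARD('a) ^ i) = x ^ (CARD('a) ^ j)"
      by (metis linorder_neqE_nat)
    \<comment> \<open>Injectivity of Frobenius lets a repetition be shifted back to the start of the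
      orbit.\<close>
    have period: "b - a > 0 \<and> x \<in> ac_subfield (b - a)" if "a < b" "x ^ (CARD('a) ^ a) = x ^ (CARD('a) ^ b)" for a b
    proof -
      have "x ^ (CARD('a) ^ b) = (x ^ (CARD('a) ^ (b - a))) ^ (CARD('a) ^ a)"
        using that(1) by (simp flip: power_mult power_add)
      thus ?thesis using that frobenius_power_inject[of x a "x ^ (CARD('a) ^ (b - a))"] by (simp add: ac_subfield_def)
    qed
    define e where "e = (LEAST e. e > 0 \<and> x \<in> ac_subfield e)"
    have e: "e > 0" "x \<in> ac_subfield e"
      using LeastI[of "\<lambda>e. e > 0 \<and> x \<in> ac_subfield e", OF period[OF ij]] by (simp_all add: e_def)
    have least: "e \<le> d" if "d > 0" "x \<in> ac_subfield d" for d
      unfolding e_def using that by (intro Least_le) auto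
    have mult: "x ^ (CARD('a) ^ (e * j)) = x" for j
      by (induction j) (use e in \<open>auto simp: ac_subfield_def power_add power_mult\<close>)
    have e_dvd: "x \<in> ac_subfield d \<longleftrightarrow> e dvd d" for d
    proof
      assume d: "x \<in> ac_subfield d"
      have "x ^ (CARD('a) ^ d) = (x ^ (CARD('a) ^ (e * (d div e)))) ^ (CARD('a) ^ (d mod e))"
        by (simp flip: power_mult power_add)
      hence "x \<in> ac_subfield (d mod e)" using d unfolding mult by (simp add: ac_subfield_def)
      hence "d mod e = 0" using least[of "d mod e"] e(1) by (metis gr0I leD mod_less_divisor)
      thus "e dvd d" by auto
    next
      assume "e dvd d"
      thus "x \<in> ac_subfield d" using mult by (auto simp: ac_subfield_def elim!: dvdE)
    qed
    have dvd_iff: "frob_norm (e * j) x dvd p \<longleftrightarrow> j \<le> Polynomial.order x p" for j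
    proof
      assume "frob_norm (e * j) x dvd p"
      hence "frob_norm e x ^ j dvd p" using e by (simp add: frob_norm_mult_period)
      hence "[:- x, 1:] ^ j dvd p" using lin[OF e(1)] dvd_trans dvd_power_same by blast
      thus "j \<le> Polynomial.order x p" using p0 by (simp add: order_divides)
    next
      assume j: "j \<le> Polynomial.order x p"
      \<comment> \<open>The e conjugates within one period are distinct, hence the powers of their
        linear factors are pairwise coprime, and each divides p.\<close>
      have "(\<Prod>i<e. [:- (x ^ (CARD('a) ^ i)), 1:] ^ j) dvd p"
      proof (rule prod_dvd_if_pairwise_coprime)
        fix i
        have "j \<le> Polynomial.order (x ^ (CARD('a) ^ i)) p"
          using j order_le_order_frobenius_power[OF fixd p0, of x i] by linarith
        thus "[:- (x ^ (CARD('a) ^ i)), 1:] ^ j dvd p" by (simp add: order_divides)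
      next
        fix i i' assume i: "i \<in> {..<e}" "i' \<in> {..<e}" "i \<noteq> i'"
        have ne: "x ^ (CARD('a) ^ i) \<noteq> x ^ (CARD('a) ^ i')"
        proof
          assume eq: "x ^ (CARD('a) ^ i) = x ^ (CARD('a) ^ i')"
          show False
          proof (cases "i < i'")
            case True
            thus False using period[OF True eq] least[of "i' - i"] i by auto
          next
            case False
            thus False using period[OF _ eq[symmetric]] least[of "i - i'"] i by auto
          qed
        qed
        have "coprime [:- (x ^ (CARD('a) ^ i)), 1:] [:- (x ^ (CARD('a) ^ i')), 1:]"
        proof (rule prime_elem_imp_coprime[OF prime_elem_linear_field_poly])
          show "\<not> [:- (x ^ (CARD('a) ^ i)), 1:] dvd [:- (x ^ (CARD('a) ^ i')), 1:]"
            using ne by (subst poly_eq_0_iff_dvd[symmetric]) simp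
        qed simp
        thus "coprime ([:- (x ^ (CARD('a) ^ i)), 1:] ^ j) ([:- (x ^ (CARD('a) ^ i')), 1:] ^ j)"
          by simp
      qed simp
      thus "frob_norm (e * j) x dvd p"
        unfolding frob_norm_mult_period[OF e(2)] by (simp add: frob_norm_def prod_power_distrib)
    qed
    have "{d\<in>{1..n}. x \<in> ac_subfield d \<and> frob_norm d x dvd p} = (\<lambda>j. e * j) ` {1..Polynomial.order x p}"
    proof (intro equalityI subsetI)
      fix d assume d: "d \<in> {d\<in>{1..n}. x \<in> ac_subfield d \<and> frob_norm d x dvd p}"
      then obtain j where j: "d = e * j" using e_dvd by auto
      thus "d \<in> (\<lambda>j. e * j) ` {1..Polynomial.order x p}" using d dvd_iff[of j]
        by (intro image_eqI[of _ _ j]) (auto simp: Suc_le_eq intro: Nat.gr0I)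
    next
      fix d assume "d \<in> (\<lambda>j. e * j) ` {1..Polynomial.order x p}"
      then obtain j where j: "d = e * j" "1 \<le> j" "j \<le> Polynomial.order x p" by fastforce
      have dvd: "frob_norm d x dvd p" using dvd_iff j by simp
      have xd: "x \<in> ac_subfield d" using e_dvd j by simp
      have "Polynomial.degree (frob_norm d x) = d"
        using frob_norm_monic_fixed[OF xd] by (simp add: monic_fixed_def)
      hence "d \<le> n" using dvd_imp_degree_le[OF dvd p0] deg by simp
      thus "d \<in> {d\<in>{1..n}. x \<in> ac_subfield d \<and> frob_norm d x dvd p}"
        using dvd xd j e by (auto simp: Suc_le_eq)
    qed
    moreover have "inj_on (\<lambda>j. e * j) {1..Polynomial.order x p}" using e by (auto intro: inj_onI)
    ultimately show ?thesis by (simp add: card_image)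
  qed
qed


text \<open>The degree counts the roots with multiplicity, and each multiplicity is a count of d.
  This is the polynomial analogue of writing log n as the sum of the von Mangoldt function over the
  divisors of n.\<close>

lemma card_frob_norm_dvd:
  fixes p :: "'a::finite_field alg_closure poly"
  assumes p: "p \<in> monic_fixed n" and nz: "poly p 0 \<noteq> 0"
  shows "n = (\<Sum>d=1..n. card {x \<in> ac_subfield d - {0}. frob_norm d x dvd p})"
proof -
  have p0: "p \<noteq> 0" using p by (rule monic_fixed_nonzero)
  define R where "R = {x. poly p x = 0}"
  have fin: "finite R" unfolding R_def by (rule poly_roots_finite[OF p0])
  have "n = size (proots p)" using p by (simp add: size_proots_alg_closed monic_fixed_def)
  also have "\<dots> = (\<Sum>x\<in>R. Polynomial.order x p)"
    using p0 by (simp add: size_multiset_overloaded_eq R_def)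
  also have "\<dots> = (\<Sum>x\<in>R. \<Sum>d=1..n. if x \<in> ac_subfield d \<and> frob_norm d x dvd p then 1 else 0)"
    unfolding order_eq_card_frob_norm_dvd[OF p] by (simp flip: sum.inter_filter)
  also have "\<dots> = (\<Sum>d=1..n. \<Sum>x\<in>R. if x \<in> ac_subfield d \<and> frob_norm d x dvd p then 1 else 0)"
    by (rule sum.swap)
  also have "\<dots> = (\<Sum>d=1..n. card {x \<in> R. x \<in> ac_subfield d \<and> frob_norm d x dvd p})"
    using fin by (simp flip: sum.inter_filter)
  also have "\<dots> = (\<Sum>d=1..n. card {x \<in> ac_subfield d - {0}. frob_norm d x dvd p})"
  proof (intro sum.cong refl arg_cong[of _ _ card] Collect_cong iffI)
    fix d x assume d: "d \<in> {1..n}" and x: "x \<in> R \<and> x \<in> ac_subfield d \<and> frob_norm d x dvd p"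
    have "x \<noteq> 0" using x nz by (auto simp: R_def)
    thus "x \<in> ac_subfield d - {0} \<and> frob_norm d x dvd p" using x by simp
  next
    fix d x assume d: "d \<in> {1..n}" and x: "x \<in> ac_subfield d - {0} \<and> frob_norm d x dvd p"
    have "poly (frob_norm d x) x = 0"
      using d unfolding frob_norm_def poly_prod by (intro prod_zero bexI[of _ 0]) auto
    hence "x \<in> R" using x by (auto simp: R_def elim!: dvdE)
    thus "x \<in> R \<and> x \<in> ac_subfield d \<and> frob_norm d x dvd p" using x by simp
  qed
  finally show ?thesis .
qed

text \<open>The factor n is replaced by the number of pairs (d, x) whose norm polynomial divides p;
  after exchanging the sums, p = \<open>frob_norm d x * r\<close> splits the character. It is the
  coefficient form of the logarithmic derivative of the generating series.\<close>

lemma ac_chi_sum_recurrence: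
  fixes \<psi> :: "'a::finite_field \<Rightarrow> complex"
  assumes "additive_character \<psi>"
  shows "of_nat n * (\<Sum>p\<in>monic_fixed n. ac_chi k \<psi> p)
    = (\<Sum>d=1..n. (\<Sum>x\<in>ac_subfield d - {0}. ac_chi k \<psi> (frob_norm d x)) * (\<Sum>p\<in>monic_fixed (n - d). ac_chi k \<psi> p))"
proof -
  have fin: "finite (monic_fixed m :: 'a alg_closure poly set)" for m by (rule card_monic_fixed_le)
  have finF: "finite (ac_subfield d - {0} :: 'a alg_closure set)" if "d \<in> {1..n}" for d
    using that card_ac_subfield(1)[of d] by simp
  have "of_nat n * (\<Sum>p\<in>monic_fixed n. ac_chi k \<psi> p)
     = (\<Sum>p\<in>monic_fixed n. \<Sum>d=1..n. \<Sum>x\<in>ac_subfield d - {0}. if frob_norm d x dvd p then ac_chi k \<psi> p else 0)"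
    unfolding sum_distrib_left
  proof (intro sum.cong refl)
    fix p :: "'a alg_closure poly" assume p: "p \<in> monic_fixed n"
    show "of_nat n * ac_chi k \<psi> p = (\<Sum>d=1..n. \<Sum>x\<in>ac_subfield d - {0}. if frob_norm d x dvd p then ac_chi k \<psi> p else 0)"
    proof (cases "poly p 0 = 0")
      \<comment> \<open>The count of pairs assumes a nonzero constant term; here the character value
        is 0 and both sides vanish.\<close>
      case True
      hence "ac_chi k \<psi> p = 0" by (simp add: ac_chi_def)
      thus ?thesis by (simp only: if_cancel sum.neutral_const mult_zero_right)
    next
      case False
      have "(\<Sum>d=1..n. \<Sum>x\<in>ac_subfield d - {0}. if frob_norm d x dvd p then ac_chi k \<psi> p else 0)
          = (\<Sum>d=1..n. of_nat (card {x\<in>ac_subfield d - {0}. frob_norm d x dvd p}) * ac_chi k \<psi> p)"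
        using finF by (intro sum.cong refl, subst sum.inter_filter[symmetric]) auto
      also have "\<dots> = of_nat n * ac_chi k \<psi> p"
        by (subst (2) card_frob_norm_dvd[OF p False]) (simp only: of_nat_sum sum_distrib_right)
      finally show ?thesis by simp
    qed
  qed
  also have "\<dots> = (\<Sum>d=1..n. \<Sum>p\<in>monic_fixed n. \<Sum>x\<in>ac_subfield d - {0}. if frob_norm d x dvd p then ac_chi k \<psi> p else 0)"
    by (rule sum.swap)
  also have "\<dots> = (\<Sum>d=1..n. \<Sum>x\<in>ac_subfield d - {0}. \<Sum>p\<in>monic_fixed n. if frob_norm d x dvd p then ac_chi k \<psi> p else 0)"
    by (intro sum.cong refl sum.swap)
  also have "\<dots> = (\<Sum>d=1..n. \<Sum>x\<in>ac_subfield d - {0}. ac_chi k \<psi> (frob_norm d x) * (\<Sum>p\<in>monic_fixed (n - d). ac_chi k \<psi> p))"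
  proof (intro sum.cong refl)
    fix d and x :: "'a alg_closure" assume d: "d \<in> {1..n}" and x: "x \<in> ac_subfield d - {0}"
    have N: "frob_norm d x \<in> monic_fixed d" using x by (intro frob_norm_monic_fixed) auto
    have N0: "frob_norm d x \<noteq> 0" using N by (rule monic_fixed_nonzero)
    have img: "{p\<in>monic_fixed n. frob_norm d x dvd p} = (\<lambda>r. frob_norm d x * r) ` monic_fixed (n - d)"
      using monic_fixed_mult_iff[OF N, of _ n] d by (auto elim!: dvdE)
    have "(\<Sum>p\<in>monic_fixed n. if frob_norm d x dvd p then ac_chi k \<psi> p else 0) = (\<Sum>p\<in>{p\<in>monic_fixed n. frob_norm d x dvd p}. ac_chi k \<psi> p)"
      by (rule sum.inter_filter[symmetric]) (rule fin)
    also have "\<dots> = (\<Sum>r\<in>monic_fixed (n - d). ac_chi k \<psi> (frob_norm d x * r))"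
      unfolding img using N0 by (subst sum.reindex) (auto intro: inj_onI)
    also have "\<dots> = (\<Sum>r\<in>monic_fixed (n - d). ac_chi k \<psi> (frob_norm d x) * ac_chi k \<psi> r)"
      by (intro sum.cong refl ac_chi_mult[OF assms N])
    finally show "(\<Sum>p\<in>monic_fixed n. if frob_norm d x dvd p then ac_chi k \<psi> p else 0)
        = ac_chi k \<psi> (frob_norm d x) * (\<Sum>p\<in>monic_fixed (n - d). ac_chi k \<psi> p)"
      by (simp add: sum_distrib_left)
  qed
  finally show ?thesis by (simp only: sum_distrib_right)
qed

section \<open>From the recurrence to the mean value\<close>

lemma norm_frob_norm_sum_le:
  fixes \<psi> :: "'a::finite_field \<Rightarrow> complex"
  assumes "additive_character \<psi>" "\<exists>x. \<psi> x \<noteq> 1" "d > 0"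
  shows "norm (\<Sum>x\<in>ac_subfield d - {0}. ac_chi k \<psi> (frob_norm d x)) \<le> real CARD('a) ^ d"
    and "norm (\<Sum>x\<in>ac_subfield d - {0}. ac_chi k \<psi> (frob_norm d x))
      \<le> real (gcd k (CARD('a) ^ d - 1)) * sqrt (real CARD('a) ^ d)"
proof -
  let ?F = "ac_subfield d - {0} :: 'a alg_closure set"
  have "norm (\<Sum>x\<in>?F. ac_chi k \<psi> (frob_norm d x)) \<le> (\<Sum>x\<in>?F. 1)"
    by (intro sum_norm_le norm_ac_chi_le assms)
  also have "\<dots> \<le> real (card (ac_subfield d :: 'a alg_closure set))"
    using card_mono[OF card_ac_subfield(1)[OF assms(3)], of ?F] by simp
  finally show "norm (\<Sum>x\<in>?F. ac_chi k \<psi> (frob_norm d x)) \<le> real CARD('a) ^ d"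
    using card_ac_subfield(2)[OF assms(3), where ?'a = 'a] by simp
  have "(\<Sum>x\<in>?F. ac_chi k \<psi> (frob_norm d x)) = (\<Sum>x\<in>?F. \<psi> (of_ac (ac_trace d (inverse x ^ k))))"
    by (intro sum.cong refl ac_chi_frob_norm) auto
  \<comment> \<open>Inversion permutes the nonzero elements and makes the exponent positive.\<close>
  also have "\<dots> = (\<Sum>x\<in>?F. \<psi> (of_ac (ac_trace d (x ^ k))))"
    by (rule sum.reindex_bij_witness[of _ inverse inverse]) (auto simp: ac_subfield_def power_inverse)
  finally show "norm (\<Sum>x\<in>?F. ac_chi k \<psi> (frob_norm d x)) \<le> real (gcd k (CARD('a) ^ d - 1)) * sqrt (real CARD('a) ^ d)"
    using trace_character_sum_bound[OF assms, of k] by simp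
qed

text \<open>In the recurrence, each lower coefficient is bounded trivially by q^(n-d), the number of
  polynomials, which cancels against q^n.\<close>

lemma mean_chi_recursive_bound:
  fixes \<psi> :: "'a::finite_field \<Rightarrow> complex"
  assumes "additive_character \<psi>"
  shows "real n * norm ((\<Sum>f\<in>monic_polys n. chi k \<psi> f) / of_nat CARD('a) ^ n)
     \<le> (\<Sum>d=1..n. norm (\<Sum>x\<in>ac_subfield d - {0}. ac_chi k \<psi> (frob_norm d x)) / real CARD('a) ^ d)"
proof -
  define q where "q = real CARD('a)"
  have q: "q > 0" using CARD_finite_field_gt_1[where ?'a = 'a] by (simp add: q_def)
  define A where "A m = (\<Sum>p\<in>monic_fixed m. ac_chi k \<psi> p)" for m
  define S where "S d = (\<Sum>x\<in>ac_subfield d - {0}. ac_chi k \<psi> (frob_norm d x))" for d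
  have A: "norm (A m) \<le> q ^ m" for m
  proof -
    have "norm (A m) \<le> (\<Sum>p\<in>(monic_fixed m :: 'a alg_closure poly set). 1)"
      unfolding A_def by (intro sum_norm_le norm_ac_chi_le assms)
    also have "\<dots> \<le> real (CARD('a) ^ m)"
      using card_monic_fixed_le(2)[of m, where ?'a = 'a] by (simp only: real_of_card[symmetric] of_nat_le_iff)
    finally show ?thesis by (simp add: q_def)
  qed
  have "(\<Sum>f\<in>monic_polys n. chi k \<psi> f) = A n"
    unfolding A_def chi_eq_ac_chi by (rule sum.reindex_bij_betw[OF bij_betw_map_poly_to_ac])
  hence "real n * norm ((\<Sum>f\<in>monic_polys n. chi k \<psi> f) / of_nat CARD('a) ^ n) = norm (of_nat n * A n) / q ^ n"
    by (simp add: norm_divide norm_mult norm_power q_def)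
  also have "of_nat n * A n = (\<Sum>d=1..n. S d * A (n - d))"
    unfolding A_def S_def by (rule ac_chi_sum_recurrence[OF assms])
  also have "norm \<dots> / q ^ n \<le> (\<Sum>d=1..n. norm (S d) * q ^ (n - d)) / q ^ n"
    using q A by (intro divide_right_mono sum_norm_le) (auto simp: norm_mult intro!: mult_left_mono)
  also have "\<dots> = (\<Sum>d=1..n. norm (S d) / q ^ d)"
    unfolding sum_divide_distrib using q by (intro sum.cong refl) (auto simp: power_diff)
  finally show ?thesis unfolding S_def q_def .
qed

text \<open>An exceptional d contributes at most 1 plus a geometric term; any other d contributes at
  most \<open>q powr (d/4 + d/2 - d)\<close> = \<open>\<rho> ^ d\<close>. The first kind is counted
  by \<open>card_large_gcd_le\<close>, and the geometric terms have a bounded sum.\<close>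

lemma mean_chi_bound:
  fixes \<psi> :: "'a::finite_field \<Rightarrow> complex"
  assumes "additive_character \<psi>" "\<exists>x. \<psi> x \<noteq> 1"
  obtains C :: real where "C \<ge> 0" and
    "\<And>n k. n \<ge> 1 \<Longrightarrow> k \<ge> 1 \<Longrightarrow> norm ((\<Sum>f\<in>monic_polys n. chi k \<psi> f) / of_nat CARD('a) ^ n)
        \<le> C * ((1 + sqrt (log (real CARD('a)) (real k))) / real n)"
proof -
  define q where "q = CARD('a)"
  have q1: "q > 1" using CARD_finite_field_gt_1[where ?'a = 'a] by (simp add: q_def)
  obtain C0 :: real where C0: "C0 \<ge> 0"
    "\<And>n k. k \<ge> 1 \<Longrightarrow> real (card {d\<in>{1..n}. real q powr (real d / 4) < real (gcd k (q ^ d - 1))})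
        \<le> C0 * sqrt (1 + log (real q) (real k))"
    using card_large_gcd_le[of q] q1 by auto
  define \<rho> where "\<rho> = real q powr - (1 / 4)"
  have rho: "0 < \<rho>" "\<rho> < 1" using q1 by (auto simp: \<rho>_def powr_less_one)
  define C where "C = C0 + 1 / (1 - \<rho>)"
  have "C \<ge> 0" using C0(1) rho by (simp add: C_def)
  moreover have "norm ((\<Sum>f\<in>monic_polys n. chi k \<psi> f) / of_nat CARD('a) ^ n)
        \<le> C * ((1 + sqrt (log (real CARD('a)) (real k))) / real n)" if n: "n \<ge> 1" and k: "k \<ge> 1" for n k
  proof -
    define D where "D = {d\<in>{1..n}. real q powr (real d / 4) < real (gcd k (q ^ d - 1))}"
    define S where "S d = (\<Sum>x\<in>ac_subfield d - {0}. ac_chi k \<psi> (frob_norm d x))" for d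
    have L0: "log (real q) (real k) \<ge> 0" using q1 k by simp
    have summand: "norm (S d) / real q ^ d \<le> (if d \<in> D then 1 else 0) + \<rho> ^ d" if d: "d \<in> {1..n}" for d
    proof (cases "d \<in> D")
      case True
      have "norm (S d) / real q ^ d \<le> 1"
        using norm_frob_norm_sum_le(1)[OF assms, of d k] d q1 by (simp add: S_def q_def)
      thus ?thesis using True rho by (simp add: add_increasing2)
    next
      case False
      hence g: "real (gcd k (q ^ d - 1)) \<le> real q powr (real d / 4)" using d by (simp add: D_def)
      have "norm (S d) \<le> real (gcd k (q ^ d - 1)) * sqrt (real q ^ d)"
        using norm_frob_norm_sum_le(2)[OF assms, of d k] d by (simp add: S_def q_def)
      also have "\<dots> \<le> real q powr (real d / 4) * sqrt (real q ^ d)" using g by (intro mult_right_mono) auto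
      also have "sqrt (real q ^ d) = real q powr (real d / 2)"
        using q1 by (simp add: powr_half_sqrt[symmetric] powr_powr flip: powr_realpow)
      finally have "norm (S d) / real q ^ d \<le> real q powr (real d / 4) * real q powr (real d / 2) / real q powr real d"
        using q1 by (simp add: divide_right_mono powr_realpow)
      also have "\<dots> = real q powr (real d / 4 + real d / 2 - real d)" by (simp only: powr_add powr_diff)
      also have "real d / 4 + real d / 2 - real d = - (1 / 4) * real d" by simp
      also have "real q powr (- (1 / 4) * real d) = \<rho> ^ d"
        using rho q1 by (simp add: \<rho>_def powr_powr flip: powr_realpow)
      finally show ?thesis using False by simp
    qed
    have "real n * norm ((\<Sum>f\<in>monic_polys n. chi k \<psi> f) / of_nat CARD('a) ^ n) \<le> (\<Sum>d=1..n. norm (S d) / real q ^ d)"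
      unfolding S_def q_def by (rule mean_chi_recursive_bound[OF assms(1)])
    also have "\<dots> \<le> (\<Sum>d=1..n. (if d \<in> D then 1 else 0) + \<rho> ^ d)" by (intro sum_mono summand)
    also have "\<dots> = real (card D) + (\<Sum>d=1..n. \<rho> ^ d)"
    proof -
      have "(\<Sum>d=1..n. if d \<in> D then 1 else 0 :: real) = (\<Sum>d\<in>{d\<in>{1..n}. d \<in> D}. 1)"
        by (rule sum.inter_filter[symmetric]) simp
      also have "{d\<in>{1..n}. d \<in> D} = D" by (auto simp: D_def)
      finally show ?thesis by (simp add: sum.distrib)
    qed
    also have "\<dots> \<le> C0 * sqrt (1 + log (real q) (real k)) + 1 / (1 - \<rho>)"
    proof (rule add_mono)
      show "real (card D) \<le> C0 * sqrt (1 + log (real q) (real k))" unfolding D_def by (rule C0(2)[OF k])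
      have "(\<Sum>d=1..n. \<rho> ^ d) \<le> (\<Sum>d. \<rho> ^ d)"
        using rho by (intro sum_le_suminf) (auto simp: summable_geometric)
      thus "(\<Sum>d=1..n. \<rho> ^ d) \<le> 1 / (1 - \<rho>)" using rho by (simp add: suminf_geometric)
    qed
    also have "\<dots> \<le> C0 * (1 + sqrt (log (real q) (real k))) + 1 / (1 - \<rho>) * (1 + sqrt (log (real q) (real k)))"
    proof (rule add_mono)
      show "C0 * sqrt (1 + log (real q) (real k)) \<le> C0 * (1 + sqrt (log (real q) (real k)))"
        using C0(1) L0 sqrt_add_le_add_sqrt[of 1 "log (real q) (real k)"] by (intro mult_left_mono) auto
      show "1 / (1 - \<rho>) \<le> 1 / (1 - \<rho>) * (1 + sqrt (log (real q) (real k)))"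
        using rho L0 by (simp add: field_simps)
    qed
    also have "\<dots> = C * (1 + sqrt (log (real q) (real k)))" by (simp add: C_def algebra_simps)
    finally show ?thesis using n by (simp add: q_def field_simps)
  qed
  ultimately show ?thesis using that by blast
qed

theorem theorem1p5:
  fixes \<psi> :: "'a::finite_field \<Rightarrow> complex"
  assumes "additive_character \<psi>"
    and "\<exists>x. \<psi> x \<noteq> 1"
  shows "(\<exists>C::real. \<forall>n\<ge>1. \<forall>k\<ge>1.
            norm ((\<Sum>f\<in>monic_polys n. chi k \<psi> f) / of_nat CARD('a) ^ n)
              \<le> C * ((1 + log (real CARD('a)) (real n) + sqrt (log (real CARD('a)) (real k))) / real n))
       \<and> (\<forall>k :: nat \<Rightarrow> nat. (\<forall>n\<ge>1. k n \<ge> 1) \<longrightarrow>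
            (\<lambda>n. ln (real (k n))) \<in> o(\<lambda>n. real n ^ 2) \<longrightarrow>
            (\<lambda>n. (\<Sum>f\<in>monic_polys n. chi (k n) \<psi> f) / of_nat CARD('a) ^ n) \<longlonglongrightarrow> 0)"
proof -
  define q where "q = real CARD('a)"
  have q1: "q > 1" using CARD_finite_field_gt_1[where ?'a = 'a] by (simp add: q_def)
  define a where "a n k = (\<Sum>f\<in>monic_polys n. chi k \<psi> f) / of_nat CARD('a) ^ n" for n k
  obtain C where C: "C \<ge> 0"
    "\<And>n k. n \<ge> 1 \<Longrightarrow> k \<ge> 1 \<Longrightarrow> norm (a n k) \<le> C * ((1 + sqrt (log q (real k))) / real n)"
    using mean_chi_bound[OF assms] unfolding a_def q_def by blast
  have "norm (a n k) \<le> C * ((1 + log q (real n) + sqrt (log q (real k))) / real n)" if "n \<ge> 1" "k \<ge> 1" for n k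
  proof -
    \<comment> \<open>A nonnegative logarithm in the numerator only enlarges the bound.\<close>
    have "log q (real n) \<ge> 0" using q1 that by simp
    hence "C * ((1 + sqrt (log q (real k))) / real n) \<le> C * ((1 + log q (real n) + sqrt (log q (real k))) / real n)"
      using C(1) by (intro mult_left_mono divide_right_mono) auto
    thus ?thesis using C(2)[OF that] by linarith
  qed
  moreover have "(\<lambda>n. a n (k n)) \<longlonglongrightarrow> 0"
    if k: "\<forall>n\<ge>1. k n \<ge> 1" and o: "(\<lambda>n. ln (real (k n))) \<in> o(\<lambda>n. real n ^ 2)" for k
  proof (rule Lim_null_comparison)
    have "(\<lambda>n. ln (real (k n)) / real n ^ 2) \<longlonglongrightarrow> 0" using o by (rule smalloD_tendsto)
    hence "(\<lambda>n. C * (1 / real n + sqrt (ln (real (k n)) / real n ^ 2 / ln q))) \<longlonglongrightarrow> C * (0 + sqrt (0 / ln q))"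
      using q1 by (intro tendsto_intros lim_1_over_n) auto
    thus "(\<lambda>n. C * (1 / real n + sqrt (ln (real (k n)) / real n ^ 2 / ln q))) \<longlonglongrightarrow> 0" by simp
    show "\<forall>\<^sub>F n in sequentially. norm (a n (k n)) \<le> C * (1 / real n + sqrt (ln (real (k n)) / real n ^ 2 / ln q))"
      using eventually_ge_at_top[of 1]
    proof eventually_elim
      case (elim n)
      \<comment> \<open>Moving 1 / n inside the square root as 1 / n^2 exposes the ratio that tends
        to 0 by hypothesis.\<close>
      have "(1 + sqrt (log q (real (k n)))) / real n = 1 / real n + sqrt (ln (real (k n)) / real n ^ 2 / ln q)"
        by (simp add: log_def real_sqrt_divide real_sqrt_mult add_divide_distrib)
      thus ?case using C(2)[of n "k n"] elim k by simp
    qed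
  qed
  ultimately show ?thesis unfolding a_def q_def by blast
qed

end
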